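(* Let $q\ge 0$ and $0\le p\le q$ be integers, let $T_0,\dots,T_q\subset\mathbb{R}$ be sets, not all empty, and let $t_0\in\mathbb{R}\setminus T_p$. Let $y(t)=\theta^\top f(t)+\epsilon(t)$, where $f$ is a known $q$ times differentiable $\mathbb{R}^m$-valued function, $\theta\in\mathbb{R}^m$ is unknown, and $\epsilon$ is a zero-mean process with $q$ times differentiable covariance kernel $K(t,s)=\mathbb{E}[\epsilon(t)\epsilon(s)]$, so that $y$ is $q$ times differentiable in the mean-square sense. Suppose $y^{(i)}(t)$ is observed for all $t\in T_i$, $i=0,\dots,q$. With the notation of the context, assume that (1) the best linear unbiased estimator (BLUE) $\hat\theta_{\mathrm{BLUE}}=\int\mathbf{G}(dt)\,\mathbf{Y}(t)$ of $\theta$ exists, where $\mathbf{G}$ is some signed $m\times(q+1)$-matrix measure whose $j$-th column ($j=0,\dots,q$) is a signed vector measure on $T_j$; and (2) there exists a signed vector measure $\zeta_{p,t_0}$ of size $q+1$ which satisfies the equation $$\int\mathbf{K}^\top(t,s)\,\zeta_{p,t_0}(dt)=\frac{\partial^{p}K(s,t_0)}{\partial t_0^p}\qquad\text{for all } s\in T_i,\ i=0,\dots,q.$$ Then the BLUP measure $\mathbf{Q}_*$ for predicting $y^{(p)}(t_0)$ exists and is given by $$\mathbf{Q}_*(dt)=\zeta_{p,t_0}(dt)+\mathbf{G}^\top(dt)\,c_p,$$ where $\zeta_{p,t_0}$ is the signed measure from (2) and $$c_p=f^{(p)}(t_0)-\int\mathbf{F}(t)\,\zeta_{p,t_0}(dt).$$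 The mean squared error of the BLUP $\hat y_{p,Q_*}(t_0)$ is $$\mathrm{MSE}(\hat y_{p,Q_*}(t_0))=\left.\frac{\partial^{2p}K(t,s)}{\partial t^p\,\partial s^p}\right|_{t=t_0,\,s=t_0}+c_p^\top D f^{(p)}(t_0)-\int\mathbf{K}^\top(t,t_0)\,\mathbf{Q}_*(dt),$$ where $D=\int\int\mathbf{G}(dt)\,\mathbb{K}(t,s)\,\mathbf{G}^\top(ds)$ is the covariance matrix of $\hat\theta_{\mathrm{BLUE}}=\int\mathbf{G}(dt)\,\mathbf{Y}(t)$.
   Context: Notation: $\mathbf{Y}(t)=(y(t),y^{(1)}(t),\dots,y^{(q)}(t))^\top$; $\mathbf{F}(t)=(f(t),f^{(1)}(t),\dots,f^{(q)}(t))$, an $m\times(q+1)$ matrix; $\mathbf{K}(t,s)=\left(\frac{\partial^{j}K(t,s)}{\partial t^j}\right)_{j=0}^q$, a $(q+1)$-dimensional vector; and $\mathbb{K}(t,s)=\left(\frac{\partial^{i+j}K(t,s)}{\partial t^i\partial s^j}\right)_{i,j=0}^q$, the $(q+1)\times(q+1)$ matrix $\mathbb{E}\big[(\mathbf{Y}(t)-\mathbb{E}\mathbf{Y}(t))(\mathbf{Y}(s)-\mathbb{E}\mathbf{Y}(s))^\top\big]$. An integral against a vector or matrix measure is computed componentwise, the component with index $j$ being a signed measure on $T_j$ and integrated over $T_j$; e.g. $\int\mathbf{F}(t)\mathbf{Q}(dt)=\sum_{j=0}^q\int_{T_j}f^{(j)}(t)\,Q_j(dt)$ and $\int\mathbf{K}^\top(t,s)\zeta(dt)=\sum_{j=0}^q\int_{T_j}\frac{\partial^jK(t,s)}{\partial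 t^j}\,\zeta_j(dt)$ for $\zeta=(\zeta_0,\dots,\zeta_q)^\top$. The sets $T_0,\dots,T_q$ need not coincide, and some (but not all) may be empty. Linear predictors: for $\mathbf{Q}=(Q_0,\dots,Q_q)^\top$ with $Q_i$ a signed measure on $T_i$, $\hat y_{p,Q}(t_0)=\int\mathbf{Y}^\top(t)\mathbf{Q}(dt)=\sum_{i=0}^q\int_{T_i}y^{(i)}(t)\,Q_i(dt)$. It is unbiased if $\mathbb{E}[\hat y_{p,Q}(t_0)]=\mathbb{E}[y^{(p)}(t_0)]$, which is equivalent to $\int\mathbf{F}(t)\mathbf{Q}(dt)=f^{(p)}(t_0)$. Its mean squared error is $\mathrm{MSE}(\hat y_{p,Q}(t_0))=\mathbb{E}(y^{(p)}(t_0)-\hat y_{p,Q}(t_0))^2$. A BLUP measure is a $\mathbf{Q}_*$ such that $\hat y_{p,Q_*}(t_0)$ (the best linear unbiased predictor, BLUP) is unbiased and minimizes the MSE among all linear unbiased predictors. BLUE: a linear estimator $\int\mathbf{G}(dt)\mathbf{Y}(t)$ is unbiased for $\theta$ if $\int\mathbf{F}(t)\,\mathbf{G}^\top(dt)$ is the $m\times m$ identity matrix; it is the BLUE if it is unbiased and its covariance matrix is minimal in the Loewner order among all linear unbiased estimators.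
   Formalization: Equation (2) at s in T_i is taken after differentiating both sides i times in s, and K(t,t_0) in the last MSE integral is replaced by its p-th derivative in t_0 (covariance with y^(p)(t_0)); read literally, the MSE formula fails for some q>0 or p>0. *)

theory Defs
  imports "HOL-Probability.Probability"
begin

subsection \<open>Derivatives of functions and kernels\<close>

definition nderiv :: "nat \<Rightarrow> (real \<Rightarrow> 'a::real_normed_vector) \<Rightarrow> real \<Rightarrow> 'a" where
  "nderiv i g = ((\<lambda>h t. vector_derivative h (at t)) ^^ i) g"

definition times_differentiable :: "nat \<Rightarrow> (real \<Rightarrow> 'a::real_normed_vector) \<Rightarrow> bool" where
  "times_differentiable q g \<longleftrightarrow> (\<forall>i<q. \<forall>t. nderiv i g differentiable (at t))"

text \<open>\<open>kderiv i j K t s\<close> differentiates \<open>K\<close> \<open>i\<close> times in its first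
  and \<open>j\<close> times in its second argument, at \<open>(t, s)\<close>.\<close>

definition kderiv :: "nat \<Rightarrow> nat \<Rightarrow> (real \<Rightarrow> real \<Rightarrow> real) \<Rightarrow> real \<Rightarrow> real \<Rightarrow> real" where
  "kderiv i j K t s = nderiv i (\<lambda>u. nderiv j (K u) s) t"

text \<open>All the derivatives entering \<open>kderiv i j K\<close> with \<open>i, j \<le> q\<close> exist.\<close>

definition kernel_differentiable :: "nat \<Rightarrow> (real \<Rightarrow> real \<Rightarrow> real) \<Rightarrow> bool" where
  "kernel_differentiable q K \<longleftrightarrow>
     (\<forall>t. times_differentiable q (K t)) \<and>
     (\<forall>j\<le>q. \<forall>s. times_differentiable q (\<lambda>u. nderiv j (K u) s))"


subsection \<open>Signed measures on a set of reals\<close>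

text \<open>A (finite) signed measure on \<open>T\<close> is a countably additive function on the trace of the
  Borel sets on \<open>T\<close>; \<open>T\<close> need not be Borel and may be empty. The values of \<open>\<nu>\<close> on other
  sets are irrelevant.\<close>

definition signed_measure_on :: "real set \<Rightarrow> (real set \<Rightarrow> real) \<Rightarrow> bool" where
  "signed_measure_on T \<nu> \<longleftrightarrow> \<nu> {} = 0 \<and>
     (\<forall>A :: nat \<Rightarrow> real set. range A \<subseteq> sets (restrict_space borel T) \<longrightarrow> disjoint_family A \<longrightarrow>
        (\<lambda>n. \<nu> (A n)) sums \<nu> (\<Union>n. A n))"

definition jordan_decomposition ::
    "real set \<Rightarrow> (real set \<Rightarrow> real) \<Rightarrow> real measure \<Rightarrow> real measure \<Rightarrow> bool" where
  "jordan_decomposition T \<nu> P N \<longleftrightarrow>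
     finite_measure P \<and> finite_measure N \<and>
     sets P = sets (restrict_space borel T) \<and> sets N = sets (restrict_space borel T) \<and>
     (\<forall>A\<in>sets (restrict_space borel T). \<nu> A = measure P A - measure N A) \<and>
     (\<exists>B\<in>sets (restrict_space borel T). measure P (T - B) = 0 \<and> measure N B = 0)"

definition signed_integrable :: "real set \<Rightarrow> (real set \<Rightarrow> real) \<Rightarrow> (real \<Rightarrow> real) \<Rightarrow> bool" where
  "signed_integrable T \<nu> g \<longleftrightarrow>
     (\<exists>P N. jordan_decomposition T \<nu> P N \<and> integrable P g \<and> integrable N g)"

text \<open>The Jordan decomposition is unique, so this description is well defined.\<close>

definition signed_integral :: "real set \<Rightarrow> (real set \<Rightarrow> real) \<Rightarrow> (real \<Rightarrow> real) \<Rightarrow> real" where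
  "signed_integral T \<nu> g =
     (THE x. \<exists>P N. jordan_decomposition T \<nu> P N \<and> x = integral\<^sup>L P g - integral\<^sup>L N g)"


subsection \<open>Mean-square calculus\<close>

text \<open>A process is a function from times to real random variables on \<open>M\<close>.\<close>

definition square_integrable :: "'w measure \<Rightarrow> ('w \<Rightarrow> real) \<Rightarrow> bool" where
  "square_integrable M Z \<longleftrightarrow> Z \<in> borel_measurable M \<and> integrable M (\<lambda>\<omega>. (Z \<omega>)\<^sup>2)"

definition has_ms_derivative ::
    "'w measure \<Rightarrow> (real \<Rightarrow> 'w \<Rightarrow> real) \<Rightarrow> real \<Rightarrow> ('w \<Rightarrow> real) \<Rightarrow> bool" where
  "has_ms_derivative M X t Z \<longleftrightarrow> square_integrable M Z \<and>
     ((\<lambda>h. integral\<^sup>L M (\<lambda>\<omega>. ((X (t + h) \<omega> - X t \<omega>) / h - Z \<omega>)\<^sup>2)) \<longlongrightarrow> 0) (at 0)"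

text \<open>Mean-square derivatives are determined almost surely; \<open>ms_nderiv\<close> picks a version.\<close>

definition ms_nderiv :: "'w measure \<Rightarrow> nat \<Rightarrow> (real \<Rightarrow> 'w \<Rightarrow> real) \<Rightarrow> real \<Rightarrow> 'w \<Rightarrow> real" where
  "ms_nderiv M i X = ((\<lambda>V t. SOME Z. has_ms_derivative M V t Z) ^^ i) X"

definition ms_times_differentiable :: "'w measure \<Rightarrow> nat \<Rightarrow> (real \<Rightarrow> 'w \<Rightarrow> real) \<Rightarrow> bool" where
  "ms_times_differentiable M q X \<longleftrightarrow>
     (\<forall>t. square_integrable M (X t)) \<and>
     (\<forall>i<q. \<forall>t. \<exists>Z. has_ms_derivative M (ms_nderiv M i X) t Z)"

text \<open>The mean-square integral \<open>\<integral>\<^sub>T X(t) \<nu>(dt)\<close>, as a weak (Pettis) integral in the Hilbert space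
  of square-integrable random variables. Unlike a pathwise integral it depends neither on the
  chosen versions of the \<open>X t\<close> nor on joint measurability. It is determined almost surely.\<close>

definition has_ms_integral ::
    "'w measure \<Rightarrow> real set \<Rightarrow> (real set \<Rightarrow> real) \<Rightarrow> (real \<Rightarrow> 'w \<Rightarrow> real) \<Rightarrow> ('w \<Rightarrow> real) \<Rightarrow> bool" where
  "has_ms_integral M T \<nu> X Z \<longleftrightarrow> square_integrable M Z \<and>
     (\<forall>W. square_integrable M W \<longrightarrow>
        signed_integrable T \<nu> (\<lambda>t. integral\<^sup>L M (\<lambda>\<omega>. W \<omega> * X t \<omega>)) \<and>
        integral\<^sup>L M (\<lambda>\<omega>. W \<omega> * Z \<omega>) =
          signed_integral T \<nu> (\<lambda>t. integral\<^sup>L M (\<lambda>\<omega>. W \<omega> * X t \<omega>)))"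

definition ms_integral ::
    "'w measure \<Rightarrow> real set \<Rightarrow> (real set \<Rightarrow> real) \<Rightarrow> (real \<Rightarrow> 'w \<Rightarrow> real) \<Rightarrow> 'w \<Rightarrow> real" where
  "ms_integral M T \<nu> X = (SOME Z. has_ms_integral M T \<nu> X Z)"


subsection \<open>The regression model and its linear statistics\<close>

definition response ::
    "(real \<Rightarrow> real ^ 'm) \<Rightarrow> (real \<Rightarrow> 'w \<Rightarrow> real) \<Rightarrow> real ^ 'm \<Rightarrow> real \<Rightarrow> 'w \<Rightarrow> real" where
  "response f \<epsilon> \<theta> t \<omega> = \<theta> \<bullet> f t + \<epsilon> t \<omega>"

definition response_deriv ::
    "'w measure \<Rightarrow> (real \<Rightarrow> real ^ 'm) \<Rightarrow> (real \<Rightarrow> 'w \<Rightarrow> real) \<Rightarrow> real ^ 'm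
      \<Rightarrow> nat \<Rightarrow> real \<Rightarrow> 'w \<Rightarrow> real" where
  "response_deriv M f \<epsilon> \<theta> i = ms_nderiv M i (response f \<epsilon> \<theta>)"

text \<open>A signed vector measure \<open>Q = (Q 0, \<dots>, Q q)\<close> with \<open>Q i\<close> on \<open>T i\<close>, for which the linear statistic
  \<open>\<integral> Y\<^sup>T(t) Q(dt)\<close> is defined, whatever the unknown parameter \<open>\<theta>\<close>.\<close>

definition vector_measure ::
    "'w measure \<Rightarrow> (real \<Rightarrow> real ^ 'm) \<Rightarrow> (real \<Rightarrow> 'w \<Rightarrow> real) \<Rightarrow> nat \<Rightarrow> (nat \<Rightarrow> real set)
      \<Rightarrow> (nat \<Rightarrow> real set \<Rightarrow> real) \<Rightarrow> bool" where
  "vector_measure M f \<epsilon> q T Q \<longleftrightarrow>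
     (\<forall>i\<le>q. signed_measure_on (T i) (Q i) \<and>
        (\<forall>\<theta>. \<exists>Z. has_ms_integral M (T i) (Q i) (response_deriv M f \<epsilon> \<theta> i) Z))"

definition linear_statistic ::
    "'w measure \<Rightarrow> (real \<Rightarrow> real ^ 'm) \<Rightarrow> (real \<Rightarrow> 'w \<Rightarrow> real) \<Rightarrow> nat \<Rightarrow> (nat \<Rightarrow> real set)
      \<Rightarrow> (nat \<Rightarrow> real set \<Rightarrow> real) \<Rightarrow> real ^ 'm \<Rightarrow> 'w \<Rightarrow> real" where
  "linear_statistic M f \<epsilon> q T Q \<theta> \<omega> =
     (\<Sum>i\<le>q. ms_integral M (T i) (Q i) (response_deriv M f \<epsilon> \<theta> i) \<omega>)"

text \<open>The vector \<open>\<integral> F(t) Q(dt)\<close>.\<close>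

definition regressor_integral ::
    "(real \<Rightarrow> real ^ 'm) \<Rightarrow> nat \<Rightarrow> (nat \<Rightarrow> real set) \<Rightarrow> (nat \<Rightarrow> real set \<Rightarrow> real) \<Rightarrow> real ^ 'm" where
  "regressor_integral f q T Q =
     (\<chi> k. \<Sum>j\<le>q. signed_integral (T j) (Q j) (\<lambda>t. nderiv j f t $ k))"


subsection \<open>Best linear unbiased prediction\<close>

text \<open>The parameter \<open>\<theta>\<close> is unknown, hence unbiasedness and optimality refer to every \<open>\<theta>\<close>.\<close>

definition unbiased_predictor ::
    "'w measure \<Rightarrow> (real \<Rightarrow> real ^ 'm) \<Rightarrow> (real \<Rightarrow> 'w \<Rightarrow> real) \<Rightarrow> nat \<Rightarrow> (nat \<Rightarrow> real set)
      \<Rightarrow> nat \<Rightarrow> real \<Rightarrow> (nat \<Rightarrow> real set \<Rightarrow> real) \<Rightarrow> bool" where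
  "unbiased_predictor M f \<epsilon> q T p t0 Q \<longleftrightarrow>
     vector_measure M f \<epsilon> q T Q \<and>
     (\<forall>\<theta>. integral\<^sup>L M (linear_statistic M f \<epsilon> q T Q \<theta>) =
           integral\<^sup>L M (response_deriv M f \<epsilon> \<theta> p t0))"

definition mse ::
    "'w measure \<Rightarrow> (real \<Rightarrow> real ^ 'm) \<Rightarrow> (real \<Rightarrow> 'w \<Rightarrow> real) \<Rightarrow> nat \<Rightarrow> (nat \<Rightarrow> real set)
      \<Rightarrow> nat \<Rightarrow> real \<Rightarrow> (nat \<Rightarrow> real set \<Rightarrow> real) \<Rightarrow> real ^ 'm \<Rightarrow> real" where
  "mse M f \<epsilon> q T p t0 Q \<theta> =
     integral\<^sup>L M (\<lambda>\<omega>. (response_deriv M f \<epsilon> \<theta> p t0 \<omega> - linear_statistic M f \<epsilon> q T Q \<theta> \<omega>)\<^sup>2)"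

definition is_BLUP_measure ::
    "'w measure \<Rightarrow> (real \<Rightarrow> real ^ 'm) \<Rightarrow> (real \<Rightarrow> 'w \<Rightarrow> real) \<Rightarrow> nat \<Rightarrow> (nat \<Rightarrow> real set)
      \<Rightarrow> nat \<Rightarrow> real \<Rightarrow> (nat \<Rightarrow> real set \<Rightarrow> real) \<Rightarrow> bool" where
  "is_BLUP_measure M f \<epsilon> q T p t0 Q \<longleftrightarrow>
     unbiased_predictor M f \<epsilon> q T p t0 Q \<and>
     (\<forall>Q'. unbiased_predictor M f \<epsilon> q T p t0 Q' \<longrightarrow>
        (\<forall>\<theta>. mse M f \<epsilon> q T p t0 Q \<theta> \<le> mse M f \<epsilon> q T p t0 Q' \<theta>))"


subsection \<open>Best linear unbiased estimation\<close>

text \<open>A matrix measure \<open>G\<close> is given by its rows: \<open>G k j\<close> is the entry in row \<open>k\<close> and column \<open>j\<close>,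
  a signed measure on \<open>T j\<close>. The estimator \<open>\<integral> G(dt) Y(t)\<close> is the vector
  of the linear statistics of the rows.\<close>

definition estimator_cov ::
    "'w measure \<Rightarrow> (real \<Rightarrow> real ^ 'm) \<Rightarrow> (real \<Rightarrow> 'w \<Rightarrow> real) \<Rightarrow> nat \<Rightarrow> (nat \<Rightarrow> real set)
      \<Rightarrow> ('m \<Rightarrow> nat \<Rightarrow> real set \<Rightarrow> real) \<Rightarrow> real ^ 'm \<Rightarrow> real ^ 'm ^ 'm" where
  "estimator_cov M f \<epsilon> q T G \<theta> =
     (let Z = (\<lambda>k. linear_statistic M f \<epsilon> q T (G k) \<theta>)
      in \<chi> k l. integral\<^sup>L M (\<lambda>\<omega>. (Z k \<omega> - integral\<^sup>L M (Z k)) * (Z l \<omega> - integral\<^sup>L M (Z l))))"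

text \<open>The condition \<open>\<integral> F(t) G\<^sup>T(dt) = I\<close>, whose \<open>k\<close>-th column is the regressor integral of row \<open>k\<close> of \<open>G\<close>.\<close>

definition unbiased_estimator ::
    "'w measure \<Rightarrow> (real \<Rightarrow> real ^ 'm) \<Rightarrow> (real \<Rightarrow> 'w \<Rightarrow> real) \<Rightarrow> nat \<Rightarrow> (nat \<Rightarrow> real set)
      \<Rightarrow> ('m \<Rightarrow> nat \<Rightarrow> real set \<Rightarrow> real) \<Rightarrow> bool" where
  "unbiased_estimator M f \<epsilon> q T G \<longleftrightarrow>
     (\<forall>k. vector_measure M f \<epsilon> q T (G k)) \<and>
     (\<chi> l k. regressor_integral f q T (G k) $ l) = mat 1"

definition loewner_le :: "real ^ 'm ^ 'm \<Rightarrow> real ^ 'm ^ 'm \<Rightarrow> bool" where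
  "loewner_le A B \<longleftrightarrow> transpose (B - A) = B - A \<and> (\<forall>v. 0 \<le> v \<bullet> ((B - A) *v v))"

definition is_BLUE ::
    "'w measure \<Rightarrow> (real \<Rightarrow> real ^ 'm) \<Rightarrow> (real \<Rightarrow> 'w \<Rightarrow> real) \<Rightarrow> nat \<Rightarrow> (nat \<Rightarrow> real set)
      \<Rightarrow> ('m \<Rightarrow> nat \<Rightarrow> real set \<Rightarrow> real) \<Rightarrow> bool" where
  "is_BLUE M f \<epsilon> q T G \<longleftrightarrow>
     unbiased_estimator M f \<epsilon> q T G \<and>
     (\<forall>G'. unbiased_estimator M f \<epsilon> q T G' \<longrightarrow>
        (\<forall>\<theta>. loewner_le (estimator_cov M f \<epsilon> q T G \<theta>) (estimator_cov M f \<epsilon> q T G' \<theta>)))"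

end

theory Submission
  imports Defs
begin

text \<open>In the Hilbert space of square-integrable random variables, mean-square derivatives and integrals
  are determined by their inner products with arbitrary \<open>W\<close>, so the noise part \<open>z Q\<close> of a linear
  statistic satisfies \<open>\<langle>W, z Q\<rangle> = \<integral> \<langle>W, \<epsilon>\<^sup>(\<^sup>i\<^sup>)(t)\<rangle> Q(dt)\<close>.
  The equation for \<open>\<zeta>\<close> says that \<open>\<epsilon>\<^sup>(\<^sup>p\<^sup>)(t\<^sub>0) - z \<zeta>\<close> is orthogonal to all linear statistics, and the BLUE
  is uncorrelated with every linear statistic \<open>H\<close> such that \<open>\<integral> F dH = 0\<close>. Hence the prediction error of
  \<open>Q\<^sub>* = \<zeta> + G\<^sup>T c\<close> is orthogonal to the differences of unbiased predictors, and the optimality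
  follows from Pythagoras. Orthogonality of \<open>G\<close> to \<open>Q\<^sub>* - G\<^sup>T f\<^sup>(\<^sup>p\<^sup>)(t\<^sub>0)\<close> yields the error formula.\<close>

section \<open>Integration against signed measures\<close>

text \<open>A null set of the sum of the two measures is null for each of them. The sum is built by
  \<open>measure_of\<close> on the sigma-algebra of \<open>A\<close>.\<close>

lemma dominating_finite_measure:
  fixes A B :: "'a measure"
  assumes A: "finite_measure A" and B: "finite_measure B" and sets: "sets B = sets A"
  shows "\<exists>S. finite_measure S \<and> sets S = sets A \<and>
    absolutely_continuous S A \<and> absolutely_continuous S B"
proof -
  define \<mu> where "\<mu> = (\<lambda>X. emeasure A X + emeasure B X)"
  define S where "S = measure_of (space A) (sets A) \<mu>"
  have S_sets: "sets S = sets A"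
    by (simp add: S_def)
  have "countably_additive (sets A) \<mu>"
    unfolding countably_additive_def \<mu>_def
    by (auto simp: suminf_add[symmetric] suminf_emeasure sets)
  moreover have "positive (sets A) \<mu>"
    by (simp add: positive_def \<mu>_def)
  ultimately have S_emeasure: "emeasure S X = emeasure A X + emeasure B X" if "X \<in> sets A" for X
    using emeasure_measure_of_sigma[of "space A" "sets A" \<mu> X] that
    by (simp add: S_def \<mu>_def sets.sigma_algebra_axioms)
  have "emeasure S (space S) \<noteq> \<infinity>"
    using S_emeasure[of "space A"] sets_eq_imp_space_eq[OF S_sets]
      finite_measure.emeasure_finite[OF A] finite_measure.emeasure_finite[OF B] by simp
  then have "finite_measure S"
    by (rule finite_measureI)
  moreover have "absolutely_continuous S A" "absolutely_continuous S B"
    by (auto simp: absolutely_continuous_def null_sets_def S_sets S_emeasure sets)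
  ultimately show ?thesis
    using S_sets by blast
qed

text \<open>Radon-Nikodym. Finiteness of \<open>P\<close> makes the derivative finite almost
  everywhere, so a version can be chosen that is real and nonnegative everywhere.\<close>

lemma finite_measure_real_density:
  assumes S: "finite_measure S" and P: "finite_measure P" and ac: "absolutely_continuous S P"
    and sets: "sets P = sets S"
  obtains d :: "'a \<Rightarrow> real" where "d \<in> borel_measurable S" "\<And>x. 0 \<le> d x"
    "P = density S d"
proof -
  interpret S: finite_measure S by fact
  obtain d :: "'a \<Rightarrow> real" where d: "d \<in> borel_measurable S"
    "AE x in S. RN_deriv S P x = ennreal (d x)" "\<And>x. 0 \<le> d x"
    using S.real_RN_deriv[OF P ac sets] by metis
  have "P = density S (RN_deriv S P)"
    using S.density_RN_deriv[OF ac sets] by simp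
  also have "\<dots> = density S d"
    by (rule density_cong) (use d in auto)
  finally show thesis
    using that d by blast
qed

lemma integrable_of_density_finite:
  assumes "d \<in> borel_measurable S" "\<And>x. 0 \<le> d x" "finite_measure (density S (\<lambda>x. ennreal (d x)))"
  shows "integrable S (d :: 'a \<Rightarrow> real)"
proof -
  have "integrable (density S d) (\<lambda>x. 1 :: real)"
    using assms(3) by (simp add: finite_measure.integrable_const)
  then show ?thesis
    using assms by (subst (asm) integrable_real_density) auto
qed

text \<open>With \<open>B\<close> the Hahn set of the first decomposition, \<open>P\<close> lives on
  \<open>B\<close>, so its value at \<open>A\<close> is the value of \<open>\<nu>\<close> at
  \<open>A \<inter> B\<close>, which is at most \<open>P'\<close> at \<open>A \<inter> B\<close> and
  hence at \<open>A\<close>. The same holds for \<open>N\<close> on \<open>A - B\<close>. Exchanging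
  the two decompositions gives uniqueness.\<close>

lemma jordan_decomposition_le:
  assumes J: "jordan_decomposition T \<nu> P N" and J': "jordan_decomposition T \<nu> P' N'"
    and A: "A \<in> sets P"
  shows "measure P A \<le> measure P' A" "measure N A \<le> measure N' A"
proof -
  interpret P: finite_measure P using J by (simp add: jordan_decomposition_def)
  interpret N: finite_measure N using J by (simp add: jordan_decomposition_def)
  interpret P': finite_measure P' using J' by (simp add: jordan_decomposition_def)
  interpret N': finite_measure N' using J' by (simp add: jordan_decomposition_def)
  have sets: "sets P = sets (restrict_space borel T)" "sets N = sets P" "sets P' = sets P"
    "sets N' = sets P"
    and val: "\<And>X. X \<in> sets P \<Longrightarrow> \<nu> X = measure P X - measure N X"
      "\<And>X. X \<in> sets P \<Longrightarrow> \<nu> X = measure P' X - measure N' X"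
    using J J' by (auto simp: jordan_decomposition_def)
  have sp: "space P = T"
    using sets_eq_imp_space_eq[OF sets(1)] by (simp add: space_restrict_space)
  obtain B where B: "B \<in> sets P" "measure P (T - B) = 0" "measure N B = 0"
    using J sets by (auto simp: jordan_decomposition_def)
  have AT: "A \<subseteq> T"
    using sets.sets_into_space[OF A] sp by simp
  have AB [measurable]: "A \<inter> B \<in> sets P" "A - B \<in> sets P" "T - B \<in> sets P"
    using A B(1) by (auto simp flip: sp)
  have "measure P (A - B) \<le> measure P (T - B)" "measure N (A \<inter> B) \<le> measure N B"
    using AT AB B(1) sets by (auto intro!: P.finite_measure_mono N.finite_measure_mono)
  then have null: "measure P (A - B) = 0" "measure N (A \<inter> B) = 0"
    using B by (auto simp: measure_le_0_iff)
  have "measure P A = measure P (A \<inter> B)" "measure N A = measure N (A - B)"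
    using P.finite_measure_Union[of "A \<inter> B" "A - B"] N.finite_measure_Union[of "A \<inter> B" "A - B"]
      AB sets null by (auto simp: Int_Diff_Un Int_Diff_disjoint)
  then have "measure P A = measure P' (A \<inter> B) - measure N' (A \<inter> B)"
    "measure N A = measure N' (A - B) - measure P' (A - B)"
    using val[of "A \<inter> B"] val[of "A - B"] AB null by auto
  moreover have "measure P' (A \<inter> B) \<le> measure P' A" "measure N' (A - B) \<le> measure N' A"
    using A sets by (auto intro!: P'.finite_measure_mono N'.finite_measure_mono)
  ultimately show "measure P A \<le> measure P' A" "measure N A \<le> measure N' A"
    using measure_nonneg[of N' "A \<inter> B"] measure_nonneg[of P' "A - B"] by linarith+
qed

lemma jordan_decomposition_unique:
  assumes "jordan_decomposition T \<nu> P N" "jordan_decomposition T \<nu> P' N'"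
  shows "P' = P" "N' = N"
proof -
  have fin: "finite_measure P" "finite_measure N" "finite_measure P'" "finite_measure N'"
    and sets: "sets P' = sets P" "sets N' = sets N" "sets N = sets P"
    using assms by (auto simp: jordan_decomposition_def)
  have "measure P' A = measure P A \<and> measure N' A = measure N A" if "A \<in> sets P" for A
    using jordan_decomposition_le[OF assms] jordan_decomposition_le[OF assms(2,1)] that sets
    by (metis order_antisym)
  then show "P' = P" "N' = N"
    using fin sets by (auto intro!: measure_eqI simp: finite_measure.emeasure_eq_measure)
qed

section \<open>The integral computed from any given Jordan decomposition\<close>

lemma signed_integrable_iff:
  assumes "jordan_decomposition T \<nu> P N"
  shows "signed_integrable T \<nu> g \<longleftrightarrow> integrable P g \<and> integrable N g"
proof
  assume "signed_integrable T \<nu> g"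
  then obtain P' N' where J: "jordan_decomposition T \<nu> P' N'"
    and int: "integrable P' g" "integrable N' g"
    unfolding signed_integrable_def by blast
  show "integrable P g \<and> integrable N g"
    using int unfolding jordan_decomposition_unique[OF assms J] by simp
qed (use assms in \<open>auto simp: signed_integrable_def\<close>)

lemma signed_integral_eq:
  assumes "jordan_decomposition T \<nu> P N"
  shows "signed_integral T \<nu> g = integral\<^sup>L P g - integral\<^sup>L N g"
  unfolding signed_integral_def
proof (rule the_equality)
  fix x assume "\<exists>P N. jordan_decomposition T \<nu> P N \<and> x = integral\<^sup>L P g - integral\<^sup>L N g"
  then obtain P' N' where J: "jordan_decomposition T \<nu> P' N'"
    and x: "x = integral\<^sup>L P' g - integral\<^sup>L N' g"
    by blast
  show "x = integral\<^sup>L P g - integral\<^sup>L N g"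
    unfolding x jordan_decomposition_unique[OF assms J] ..
qed (use assms in blast)

text \<open>The predicates inside the two \<open>THE\<close> descriptions coincide, so equality
  holds even when no decomposition exists or an integrand is not integrable.\<close>

lemma signed_integral_cong:
  assumes "\<And>t. t \<in> T \<Longrightarrow> g t = h t"
  shows "signed_integral T \<nu> g = signed_integral T \<nu> h"
proof -
  have "integral\<^sup>L P g = integral\<^sup>L P h \<and> integral\<^sup>L N g = integral\<^sup>L N h"
    if "jordan_decomposition T \<nu> P N" for P N
  proof -
    have "space P = T" "space N = T"
      using that sets_eq_imp_space_eq[of _ "restrict_space borel T"]
      by (auto simp: jordan_decomposition_def space_restrict_space)
    then show ?thesis
      using assms by (auto intro!: Bochner_Integration.integral_cong)
  qed
  then have "(\<lambda>x. \<exists>P N. jordan_decomposition T \<nu> P N \<and> x = integral\<^sup>L P g - integral\<^sup>L N g) =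
     (\<lambda>x. \<exists>P N. jordan_decomposition T \<nu> P N \<and> x = integral\<^sup>L P h - integral\<^sup>L N h)"
    by (simp cong: conj_cong)
  then show ?thesis
    unfolding signed_integral_def by simp
qed

lemma signed_integral_add_scale:
  assumes "signed_integrable T \<nu> g" "signed_integrable T \<nu> h"
  shows "signed_integrable T \<nu> (\<lambda>t. g t * a + h t)"
    "signed_integral T \<nu> (\<lambda>t. g t * a + h t) = signed_integral T \<nu> g * a + signed_integral T \<nu> h"
proof -
  obtain P N where J: "jordan_decomposition T \<nu> P N"
    using assms(1) by (auto simp: signed_integrable_def)
  note [simp] = signed_integrable_iff[OF J] signed_integral_eq[OF J]
  show "signed_integrable T \<nu> (\<lambda>t. g t * a + h t)"
    "signed_integral T \<nu> (\<lambda>t. g t * a + h t) = signed_integral T \<nu> g * a + signed_integral T \<nu> h"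
    using assms by (auto simp: algebra_simps)
qed

text \<open>Every finite signed measure has a density with respect to some finite measure, and
  finitely many of them have a common dominating measure; this makes the integral linear in the
  signed measure, although the Jordan decomposition is not.\<close>

definition signed_density ::
    "real set \<Rightarrow> (real set \<Rightarrow> real) \<Rightarrow> real measure \<Rightarrow> (real \<Rightarrow> real) \<Rightarrow> bool" where
  "signed_density T \<nu> S d \<longleftrightarrow> sets S = sets (restrict_space borel T) \<and> integrable S d \<and>
     (\<forall>A\<in>sets S. \<nu> A = integral\<^sup>L S (\<lambda>t. d t * indicator A t))"

text \<open>The positive and negative parts of \<open>d\<close> are carried by disjoint sets, with
  Hahn set \<open>{d > 0}\<close>. Integrability of \<open>d\<close> makes both parts finite
  measures, whatever the total mass of \<open>S\<close>.\<close>

lemma jordan_decomposition_density: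
  assumes "signed_density T \<nu> S d"
  shows "jordan_decomposition T \<nu> (density S (\<lambda>t. max 0 (d t))) (density S (\<lambda>t. max 0 (- d t)))"
proof -
  have sets: "sets S = sets (restrict_space borel T)" and d: "integrable S d"
    and \<nu>: "\<And>A. A \<in> sets S \<Longrightarrow> \<nu> A = integral\<^sup>L S (\<lambda>t. d t * indicator A t)"
    using assms by (auto simp: signed_density_def)
  have [measurable]: "d \<in> borel_measurable S"
    using d by auto
  have sp: "space S = T"
    using sets_eq_imp_space_eq[OF sets] by (simp add: space_restrict_space)
  \<comment> \<open>A generic \<open>e\<close> serves \<open>d\<close> and \<open>- d\<close>
    alike.\<close>
  have em: "emeasure (density S (\<lambda>t. ennreal (max 0 (e t)))) A
      = ennreal (integral\<^sup>L S (\<lambda>t. max 0 (e t) * indicator A t))"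
    if "integrable S e" "A \<in> sets S" for e A
  proof -
    have "emeasure (density S (\<lambda>t. ennreal (max 0 (e t)))) A
        = (\<integral>\<^sup>+t. ennreal (max 0 (e t) * indicator A t) \<partial>S)"
      using that by (subst emeasure_density) (auto simp: ennreal_mult' ennreal_indicator)
    also have "\<dots> = ennreal (integral\<^sup>L S (\<lambda>t. max 0 (e t) * indicator A t))"
      using that by (intro nn_integral_eq_integral integrable_real_mult_indicator integrable_max)
        (auto simp: indicator_def)
    finally show ?thesis .
  qed
  have fin: "finite_measure (density S (\<lambda>t. ennreal (max 0 (e t))))" if "integrable S e" for e
    using em[OF that sets.top] by (intro finite_measureI) simp
  have me: "measure (density S (\<lambda>t. ennreal (max 0 (e t)))) A
      = integral\<^sup>L S (\<lambda>t. max 0 (e t) * indicator A t)" if "integrable S e" "A \<in> sets S" for e A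
    unfolding measure_def em[OF that] by (intro enn2real_ennreal integral_nonneg) (auto simp: indicator_def)
  have d': "integrable S (\<lambda>t. - d t)"
    using d by simp
  define B where "B = {t \<in> space S. 0 < d t}"
  have B: "B \<in> sets S"
    by (simp add: B_def)
  show ?thesis
    unfolding jordan_decomposition_def
  proof (intro conjI ballI bexI[of _ B])
    fix A assume "A \<in> sets (restrict_space borel T)"
    then have A: "A \<in> sets S"
      using sets by simp
    have "measure (density S (\<lambda>t. max 0 (d t))) A - measure (density S (\<lambda>t. max 0 (- d t))) A
      = integral\<^sup>L S (\<lambda>t. max 0 (d t) * indicator A t - max 0 (- d t) * indicator A t)"
      unfolding me[OF d A] me[OF d' A]
      by (intro Bochner_Integration.integral_diff[symmetric] integrable_real_mult_indicator integrable_max A)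
        (use d in auto)
    also have "\<dots> = \<nu> A"
      unfolding \<nu>[OF A] by (intro Bochner_Integration.integral_cong) (auto simp: max_def indicator_def)
    finally show "\<nu> A = measure (density S (\<lambda>t. max 0 (d t))) A
        - measure (density S (\<lambda>t. max 0 (- d t))) A" ..
  next
    have "integral\<^sup>L S (\<lambda>t. max 0 (d t) * indicator (T - B) t) = integral\<^sup>L S (\<lambda>t. 0)"
      by (intro Bochner_Integration.integral_cong) (auto simp: B_def sp indicator_def)
    then show "measure (density S (\<lambda>t. max 0 (d t))) (T - B) = 0"
      using B by (subst me[OF d]) (auto simp flip: sp)
  next
    have "integral\<^sup>L S (\<lambda>t. max 0 (- d t) * indicator B t) = integral\<^sup>L S (\<lambda>t. 0)"
      by (intro Bochner_Integration.integral_cong) (auto simp: B_def indicator_def)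
    then show "measure (density S (\<lambda>t. max 0 (- d t))) B = 0"
      using B by (subst me[OF d']) auto
  qed (use fin d d' sets B in auto)
qed

text \<open>Measurability of \<open>g\<close> is a separate conjunct because integrability of the
  product says nothing about \<open>g\<close> where \<open>d\<close> vanishes. Splitting
  \<open>d\<close> into its two parts reduces everything to the decomposition above.\<close>

lemma signed_integral_density:
  assumes "signed_density T \<nu> S d"
  shows "signed_integrable T \<nu> g \<longleftrightarrow> g \<in> borel_measurable S \<and> integrable S (\<lambda>t. d t * g t)"
    "signed_integrable T \<nu> g \<Longrightarrow> signed_integral T \<nu> g = integral\<^sup>L S (\<lambda>t. d t * g t)"
proof -
  note J = jordan_decomposition_density[OF assms]
  have [measurable]: "d \<in> borel_measurable S"
    using assms by (auto simp: signed_density_def)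
  have split: "d t * g t = max 0 (d t) * g t - max 0 (- d t) * g t" for t
    by (auto simp: max_def)
  have meas: "g \<in> borel_measurable S" if "signed_integrable T \<nu> g"
    using that unfolding signed_integrable_iff[OF J] by auto
  have iff: "signed_integrable T \<nu> g \<longleftrightarrow>
      integrable S (\<lambda>t. max 0 (d t) * g t) \<and> integrable S (\<lambda>t. max 0 (- d t) * g t)"
    if "g \<in> borel_measurable S"
    unfolding signed_integrable_iff[OF J]
    using that by (subst (1 2) integrable_real_density) auto
  have "integrable S (\<lambda>t. max 0 (e t) * g t)"
    if "g \<in> borel_measurable S" "integrable S (\<lambda>t. d t * g t)" "e \<in> borel_measurable S"
      "\<And>t. \<bar>e t\<bar> = \<bar>d t\<bar>" for e
  proof (rule Bochner_Integration.integrable_bound[OF that(2)])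
    have "\<bar>max 0 (e t)\<bar> \<le> \<bar>d t\<bar>" for t
      unfolding that(4)[symmetric] by simp
    then show "AE t in S. norm (max 0 (e t) * g t) \<le> norm (d t * g t)"
      unfolding abs_mult real_norm_def by (intro AE_I2 mult_right_mono abs_ge_zero)
  qed (use that in measurable)
  from this[of d] this[of "\<lambda>t. - d t"]
  have "integrable S (\<lambda>t. max 0 (d t) * g t)" "integrable S (\<lambda>t. max 0 (- d t) * g t)"
    if "g \<in> borel_measurable S" "integrable S (\<lambda>t. d t * g t)"
    using that by auto
  moreover have "integrable S (\<lambda>t. d t * g t)"
    if "integrable S (\<lambda>t. max 0 (d t) * g t)" "integrable S (\<lambda>t. max 0 (- d t) * g t)"
    unfolding split using that by (rule Bochner_Integration.integrable_diff)
  ultimately show "signed_integrable T \<nu> g \<longleftrightarrow> g \<in> borel_measurable S \<and> integrable S (\<lambda>t. d t * g t)"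
    using iff meas by blast
  show "signed_integral T \<nu> g = integral\<^sup>L S (\<lambda>t. d t * g t)" if "signed_integrable T \<nu> g"
    unfolding signed_integral_eq[OF J] split
    using meas[OF that] iff that by (subst (1 2) integral_real_density) auto
qed

text \<open>The density is the difference of the Radon-Nikodym densities of \<open>P\<close> and
  \<open>N\<close>.\<close>

lemma signed_density_exists:
  assumes "jordan_decomposition T \<nu> P N" "finite_measure S"
    "sets S = sets (restrict_space borel T)" "absolutely_continuous S P" "absolutely_continuous S N"
  shows "\<exists>d. signed_density T \<nu> S d"
proof -
  have fin: "finite_measure P" "finite_measure N" and sets: "sets P = sets S" "sets N = sets S"
    and \<nu>: "\<And>A. A \<in> sets S \<Longrightarrow> \<nu> A = measure P A - measure N A"
    using assms by (auto simp: jordan_decomposition_def)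
  obtain d :: "real \<Rightarrow> real" where d: "d \<in> borel_measurable S" "\<And>x. 0 \<le> d x" "P = density S d"
    by (rule finite_measure_real_density[OF assms(2) fin(1) assms(4) sets(1)]) (rule that)
  obtain e :: "real \<Rightarrow> real" where e: "e \<in> borel_measurable S" "\<And>x. 0 \<le> e x" "N = density S e"
    by (rule finite_measure_real_density[OF assms(2) fin(2) assms(5) sets(2)]) (rule that)
  have int: "integrable S d" "integrable S e"
    using integrable_of_density_finite[of d S] integrable_of_density_finite[of e S] d e fin by auto
  have "\<nu> A = integral\<^sup>L S (\<lambda>t. (d t - e t) * indicator A t)" if A: "A \<in> sets S" for A
  proof -
    have "\<nu> A = integral\<^sup>L P (indicator A) - integral\<^sup>L N (indicator A)"
      using \<nu>[OF A] A sets sets_eq_imp_space_eq[OF sets(1)] sets_eq_imp_space_eq[OF sets(2)]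
        sets.sets_into_space[OF A] by (simp add: Int_absorb1 Int_absorb2)
    also have "\<dots> = integral\<^sup>L S (\<lambda>t. d t * indicator A t) - integral\<^sup>L S (\<lambda>t. e t * indicator A t)"
      unfolding d(3) e(3) using d e A by (subst (1 2) integral_real_density) auto
    also have "\<dots> = integral\<^sup>L S (\<lambda>t. d t * indicator A t - e t * indicator A t)"
      by (intro Bochner_Integration.integral_diff[symmetric] integrable_real_mult_indicator int A)
    finally show ?thesis
      by (simp add: algebra_simps)
  qed
  then have "signed_density T \<nu> S (\<lambda>t. d t - e t)"
    using int assms(3) by (simp add: signed_density_def)
  then show ?thesis by blast
qed

text \<open>Domination is applied three times: to the parts of \<open>\<nu>\<close>, to those of
  \<open>\<nu>'\<close>, and to the two resulting measures. Transitivity of absolute continuity then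
  covers all four parts.\<close>

lemma common_signed_density:
  assumes "jordan_decomposition T \<nu> P N" "jordan_decomposition T \<nu>' P' N'"
  shows "\<exists>S d d'. signed_density T \<nu> S d \<and> signed_density T \<nu>' S d'"
proof -
  have fin: "finite_measure P" "finite_measure N" "finite_measure P'" "finite_measure N'"
    and sets: "sets P = sets (restrict_space borel T)" "sets N = sets P" "sets P' = sets P"
      "sets N' = sets P'"
    using assms by (auto simp: jordan_decomposition_def)
  obtain A where A: "finite_measure A" "sets A = sets P" "absolutely_continuous A P"
    "absolutely_continuous A N"
    using dominating_finite_measure fin sets by metis
  obtain B where B: "finite_measure B" "sets B = sets P'" "absolutely_continuous B P'"
    "absolutely_continuous B N'"
    using dominating_finite_measure fin sets by metis
  obtain S where S: "finite_measure S" "sets S = sets A" "absolutely_continuous S A"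
    "absolutely_continuous S B"
    using dominating_finite_measure A B sets by metis
  have "absolutely_continuous S P" "absolutely_continuous S N" "absolutely_continuous S P'"
    "absolutely_continuous S N'"
    using A(3,4) B(3,4) S(3,4) unfolding absolutely_continuous_def by (meson subset_trans)+
  moreover have "sets S = sets (restrict_space borel T)"
    using S A sets by simp
  ultimately show ?thesis
    using signed_density_exists[OF assms(1) S(1)] signed_density_exists[OF assms(2) S(1)] by blast
qed

text \<open>Relative to a common \<open>S\<close> the combined measure has density
  \<open>d + a * d'\<close>, so linearity in the measure becomes linearity of the integral against
  \<open>S\<close>.\<close>

lemma signed_integral_measure_add_scale:
  assumes "signed_integrable T \<nu> g" "signed_integrable T \<nu>' g"
  shows "signed_integrable T (\<lambda>A. \<nu> A + a * \<nu>' A) g"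
    "signed_integral T (\<lambda>A. \<nu> A + a * \<nu>' A) g = signed_integral T \<nu> g + a * signed_integral T \<nu>' g"
proof -
  obtain S d d' where S: "signed_density T \<nu> S d" "signed_density T \<nu>' S d'"
    using assms common_signed_density unfolding signed_integrable_def by metis
  have int: "integrable S d" "integrable S d'"
    and val: "\<And>A. A \<in> sets S \<Longrightarrow> \<nu> A = integral\<^sup>L S (\<lambda>t. d t * indicator A t)"
      "\<And>A. A \<in> sets S \<Longrightarrow> \<nu>' A = integral\<^sup>L S (\<lambda>t. d' t * indicator A t)"
    using S by (auto simp: signed_density_def)
  have "\<nu> A + a * \<nu>' A = integral\<^sup>L S (\<lambda>t. (d t + a * d' t) * indicator A t)"
    if A: "A \<in> sets S" for A
    using val[OF A] integrable_real_mult_indicator[OF A int(1)]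
      integrable_real_mult_indicator[OF A int(2)] by (simp add: distrib_right mult.assoc)
  then have D: "signed_density T (\<lambda>A. \<nu> A + a * \<nu>' A) S (\<lambda>t. d t + a * d' t)"
    using S by (simp add: signed_density_def)
  have g: "g \<in> borel_measurable S" "integrable S (\<lambda>t. d t * g t)" "integrable S (\<lambda>t. d' t * g t)"
    using assms signed_integral_density(1)[OF S(1)] signed_integral_density(1)[OF S(2)] by auto
  show I: "signed_integrable T (\<lambda>A. \<nu> A + a * \<nu>' A) g"
    unfolding signed_integral_density(1)[OF D] using g by (simp add: distrib_right mult.assoc)
  show "signed_integral T (\<lambda>A. \<nu> A + a * \<nu>' A) g = signed_integral T \<nu> g + a * signed_integral T \<nu>' g"
    unfolding signed_integral_density(2)[OF D I] signed_integral_density(2)[OF S(1) assms(1)]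
      signed_integral_density(2)[OF S(2) assms(2)]
    using g by (simp add: distrib_right mult.assoc)
qed

lemma signed_measure_on_add_scale:
  assumes "signed_measure_on T \<nu>" "signed_measure_on T \<nu>'"
  shows "signed_measure_on T (\<lambda>A. \<nu> A + a * \<nu>' A)"
  using assms unfolding signed_measure_on_def by (simp add: sums_add sums_mult)

text \<open>Nonemptiness of \<open>I\<close> supplies an integrable \<open>g k\<close>, and with it
  a Jordan decomposition of \<open>\<nu>\<close>; an empty sum would provide none.\<close>

lemma signed_integral_sum_scale:
  assumes "finite I" "I \<noteq> {}" "\<And>k. k \<in> I \<Longrightarrow> signed_integrable T \<nu> (g k)"
  shows "signed_integrable T \<nu> (\<lambda>t. \<Sum>k\<in>I. a k * g k t)"
    "signed_integral T \<nu> (\<lambda>t. \<Sum>k\<in>I. a k * g k t) = (\<Sum>k\<in>I. a k * signed_integral T \<nu> (g k))"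
proof -
  obtain P N where J: "jordan_decomposition T \<nu> P N"
    using assms(2,3) unfolding signed_integrable_def by blast
  have int: "integrable P (g k)" "integrable N (g k)" if "k \<in> I" for k
    using assms(3)[OF that] by (simp_all add: signed_integrable_iff[OF J])
  show "signed_integrable T \<nu> (\<lambda>t. \<Sum>k\<in>I. a k * g k t)"
    unfolding signed_integrable_iff[OF J] using int by auto
  show "signed_integral T \<nu> (\<lambda>t. \<Sum>k\<in>I. a k * g k t) = (\<Sum>k\<in>I. a k * signed_integral T \<nu> (g k))"
    unfolding signed_integral_eq[OF J] using int
    by (simp add: right_diff_distrib sum_subtractf)
qed

section \<open>Square-integrable random variables\<close>

lemma square_integrable_mult:
  assumes "square_integrable M X" "square_integrable M Y"
  shows "integrable M (\<lambda>\<omega>. X \<omega> * Y \<omega>)"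
proof (rule Bochner_Integration.integrable_bound)
  show "integrable M (\<lambda>\<omega>. (X \<omega>)\<^sup>2 + (Y \<omega>)\<^sup>2)"
    using assms by (simp add: square_integrable_def)
  show "(\<lambda>\<omega>. X \<omega> * Y \<omega>) \<in> borel_measurable M"
    using assms by (auto simp: square_integrable_def)
  have "norm (x * y) \<le> norm (x\<^sup>2 + y\<^sup>2)" for x y :: real
  proof -
    have "2 * \<bar>x\<bar> * \<bar>y\<bar> \<le> x\<^sup>2 + y\<^sup>2" "0 \<le> \<bar>x\<bar> * \<bar>y\<bar>"
      using sum_squares_bound[of "\<bar>x\<bar>" "\<bar>y\<bar>"] by simp_all
    then show ?thesis
      unfolding real_norm_def abs_mult by linarith
  qed
  then show "AE \<omega> in M. norm (X \<omega> * Y \<omega>) \<le> norm ((X \<omega>)\<^sup>2 + (Y \<omega>)\<^sup>2)"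
    by (intro AE_I2)
qed

lemma square_integrable_add:
  assumes "square_integrable M X" "square_integrable M Y"
  shows "square_integrable M (\<lambda>\<omega>. X \<omega> + Y \<omega>)"
  using assms square_integrable_mult[OF assms]
  by (auto simp: square_integrable_def power2_sum mult.assoc)

lemma square_integrable_scale:
  assumes "square_integrable M X"
  shows "square_integrable M (\<lambda>\<omega>. a * X \<omega>)"
  using assms by (auto simp: square_integrable_def power_mult_distrib)

lemma square_integrable_diff:
  assumes "square_integrable M X" "square_integrable M Y"
  shows "square_integrable M (\<lambda>\<omega>. X \<omega> - Y \<omega>)"
  using square_integrable_add[OF assms(1) square_integrable_scale[OF assms(2), of "-1"]] by simp

lemma square_integrable_const:
  assumes "finite_measure M"
  shows "square_integrable M (\<lambda>\<omega>. a)"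
  using assms by (simp add: square_integrable_def finite_measure.integrable_const)

lemma square_integrable_sum:
  assumes "finite_measure M" "\<And>i. i \<in> I \<Longrightarrow> square_integrable M (X i)"
  shows "square_integrable M (\<lambda>\<omega>. \<Sum>i\<in>I. X i \<omega>)"
  using assms(2)
  by (induction I rule: infinite_finite_induct)
    (auto intro: square_integrable_const assms(1) square_integrable_add)

text \<open>Testing with \<open>W = X - Y\<close> shows that the difference has second moment zero.
  This turns identities between inner products into almost sure identities.\<close>

lemma AE_eq_of_weak_eq:
  assumes "square_integrable M X" "square_integrable M Y"
    and "\<And>W. square_integrable M W \<Longrightarrow>
      integral\<^sup>L M (\<lambda>\<omega>. W \<omega> * X \<omega>) = integral\<^sup>L M (\<lambda>\<omega>. W \<omega> * Y \<omega>)"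
  shows "AE \<omega> in M. X \<omega> = Y \<omega>"
proof -
  define W where "W = (\<lambda>\<omega>. X \<omega> - Y \<omega>)"
  have W: "square_integrable M W"
    unfolding W_def by (intro square_integrable_diff assms)
  have "integral\<^sup>L M (\<lambda>\<omega>. (W \<omega>)\<^sup>2) = integral\<^sup>L M (\<lambda>\<omega>. W \<omega> * X \<omega> - W \<omega> * Y \<omega>)"
    by (simp add: W_def power2_eq_square algebra_simps)
  also have "\<dots> = 0"
    using assms(3)[OF W] by (simp add: square_integrable_mult W assms)
  finally have "AE \<omega> in M. (W \<omega>)\<^sup>2 = 0"
    using W by (subst (asm) integral_nonneg_eq_0_iff_AE) (auto simp: square_integrable_def)
  then show ?thesis
    by (simp add: W_def)
qed

text \<open>It yields the Cauchy-Schwarz inequality, and with \<open>a = 0\<close> it forces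
  \<open>b = 0\<close>, the variational argument for the BLUE.\<close>

lemma nonneg_quadratic_discriminant:
  fixes a b c :: real
  assumes "\<And>t. 0 \<le> a + 2 * t * b + t\<^sup>2 * c" "0 \<le> c"
  shows "b\<^sup>2 \<le> a * c"
proof (cases "c = 0")
  case True
  have "b = 0"
  proof (rule ccontr)
    assume "b \<noteq> 0"
    \<comment> \<open>With \<open>c = 0\<close> the form is affine in \<open>t\<close>, and this
      choice of \<open>t\<close> gives it the value -1.\<close>
    then show False
      using assms(1)[of "- (a + 1) / (2 * b)"] True by (simp add: field_simps)
  qed
  then show ?thesis
    using True by simp
next
  case False
  \<comment> \<open>The form is evaluated at its minimiser \<open>- b / c\<close>.\<close>
  then have "0 \<le> a - b\<^sup>2 / c"
    using assms(1)[of "- b / c"] by (simp add: field_simps power2_eq_square)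
  then show ?thesis
    using False assms(2) by (simp add: field_simps)
qed

lemma integral_cauchy_schwarz:
  assumes "square_integrable M X" "square_integrable M Y"
  shows "(integral\<^sup>L M (\<lambda>\<omega>. X \<omega> * Y \<omega>))\<^sup>2
    \<le> integral\<^sup>L M (\<lambda>\<omega>. (X \<omega>)\<^sup>2) * integral\<^sup>L M (\<lambda>\<omega>. (Y \<omega>)\<^sup>2)"
proof (rule nonneg_quadratic_discriminant)
  have int: "integrable M (\<lambda>\<omega>. (X \<omega>)\<^sup>2)" "integrable M (\<lambda>\<omega>. X \<omega> * Y \<omega>)"
    "integrable M (\<lambda>\<omega>. (Y \<omega>)\<^sup>2)"
    using assms square_integrable_mult[OF assms] by (simp_all add: square_integrable_def)
  fix t :: real
  have "0 \<le> integral\<^sup>L M (\<lambda>\<omega>. (X \<omega> + t * Y \<omega>)\<^sup>2)"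
    by simp
  also have "(\<lambda>\<omega>. (X \<omega> + t * Y \<omega>)\<^sup>2)
      = (\<lambda>\<omega>. (X \<omega>)\<^sup>2 + 2 * t * (X \<omega> * Y \<omega>) + t\<^sup>2 * (Y \<omega>)\<^sup>2)"
    by (simp add: power2_eq_square algebra_simps)
  finally show "0 \<le> integral\<^sup>L M (\<lambda>\<omega>. (X \<omega>)\<^sup>2)
      + 2 * t * integral\<^sup>L M (\<lambda>\<omega>. X \<omega> * Y \<omega>) + t\<^sup>2 * integral\<^sup>L M (\<lambda>\<omega>. (Y \<omega>)\<^sup>2)"
    using int by simp
qed simp

text \<open>By Cauchy-Schwarz, convergence of the difference quotients in mean square implies
  convergence of their inner products with any fixed \<open>W\<close>.\<close>

lemma has_real_derivative_of_ms_derivative: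
  assumes X: "\<And>s. square_integrable M (X s)" and Z: "has_ms_derivative M X t Z"
    and W: "square_integrable M W"
  shows "((\<lambda>s. integral\<^sup>L M (\<lambda>\<omega>. W \<omega> * X s \<omega>)) has_real_derivative
    integral\<^sup>L M (\<lambda>\<omega>. W \<omega> * Z \<omega>)) (at t)"
proof -
  define U where "U = (\<lambda>h \<omega>. (X (t + h) \<omega> - X t \<omega>) / h - Z \<omega>)"
  have Z_sq: "square_integrable M Z"
    and U_lim: "((\<lambda>h. integral\<^sup>L M (\<lambda>\<omega>. (U h \<omega>)\<^sup>2)) \<longlongrightarrow> 0) (at 0)"
    using Z by (auto simp: has_ms_derivative_def U_def)
  have U_sq: "square_integrable M (U h)" for h
    unfolding U_def using square_integrable_scale[OF square_integrable_diff[OF X X], of "1 / h"]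
    by (intro square_integrable_diff Z_sq) simp
  have "((\<lambda>h. (integral\<^sup>L M (\<lambda>\<omega>. W \<omega> * U h \<omega>))\<^sup>2) \<longlongrightarrow> 0) (at 0)"
  proof (rule tendsto_sandwich[where f = "\<lambda>_. 0"
        and h = "\<lambda>h. integral\<^sup>L M (\<lambda>\<omega>. (W \<omega>)\<^sup>2) * integral\<^sup>L M (\<lambda>\<omega>. (U h \<omega>)\<^sup>2)"])
    show "((\<lambda>h. integral\<^sup>L M (\<lambda>\<omega>. (W \<omega>)\<^sup>2) * integral\<^sup>L M (\<lambda>\<omega>. (U h \<omega>)\<^sup>2)) \<longlongrightarrow> 0) (at 0)"
      using tendsto_mult_left[OF U_lim] by simp
    show "\<forall>\<^sub>F h in at 0. (integral\<^sup>L M (\<lambda>\<omega>. W \<omega> * U h \<omega>))\<^sup>2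
        \<le> integral\<^sup>L M (\<lambda>\<omega>. (W \<omega>)\<^sup>2) * integral\<^sup>L M (\<lambda>\<omega>. (U h \<omega>)\<^sup>2)"
      by (intro always_eventually allI integral_cauchy_schwarz W U_sq)
  qed auto
  then have "((\<lambda>h. integral\<^sup>L M (\<lambda>\<omega>. W \<omega> * U h \<omega>)) \<longlongrightarrow> 0) (at 0)"
    using tendsto_real_sqrt[of _ 0] by (simp add: tendsto_rabs_zero_iff)
  moreover have "integral\<^sup>L M (\<lambda>\<omega>. W \<omega> * U h \<omega>) =
      (integral\<^sup>L M (\<lambda>\<omega>. W \<omega> * X (t + h) \<omega>) - integral\<^sup>L M (\<lambda>\<omega>. W \<omega> * X t \<omega>)) / h
        - integral\<^sup>L M (\<lambda>\<omega>. W \<omega> * Z \<omega>)" for h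
  proof -
    have "(\<lambda>\<omega>. W \<omega> * U h \<omega>) = (\<lambda>\<omega>. (W \<omega> * X (t + h) \<omega> - W \<omega> * X t \<omega>) / h - W \<omega> * Z \<omega>)"
      by (simp add: U_def algebra_simps diff_divide_distrib)
    then show ?thesis
      by (simp add: square_integrable_mult W X Z_sq)
  qed
  ultimately have "((\<lambda>h. (integral\<^sup>L M (\<lambda>\<omega>. W \<omega> * X (t + h) \<omega>) - integral\<^sup>L M (\<lambda>\<omega>. W \<omega> * X t \<omega>)) / h
      - integral\<^sup>L M (\<lambda>\<omega>. W \<omega> * Z \<omega>)) \<longlongrightarrow> 0) (at 0)"
    by simp
  then show ?thesis
    unfolding DERIV_def by (rule LIM_zero_cancel)
qed

section \<open>The regression model\<close>

locale ms_regression = prob_space M for M :: "'w measure" +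
  fixes f :: "real \<Rightarrow> real ^ 'm" and \<epsilon> :: "real \<Rightarrow> 'w \<Rightarrow> real"
    and q :: nat and T :: "nat \<Rightarrow> real set"
  assumes f_differentiable: "times_differentiable q f"
    and noise_mean: "\<And>t. expectation (\<epsilon> t) = 0"
    and ms_differentiable: "\<And>\<theta>. ms_times_differentiable M q (response f \<epsilon> \<theta>)"
begin

abbreviation cross :: "('w \<Rightarrow> real) \<Rightarrow> ('w \<Rightarrow> real) \<Rightarrow> real" where
  "cross X Y \<equiv> integral\<^sup>L M (\<lambda>\<omega>. X \<omega> * Y \<omega>)"

abbreviation deriv_process :: "real ^ 'm \<Rightarrow> nat \<Rightarrow> real \<Rightarrow> 'w \<Rightarrow> real" where
  "deriv_process \<equiv> response_deriv M f \<epsilon>"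

text \<open>The parameter 0 makes the response equal to the noise, so the differentiability of the
  response for every parameter covers the noise as well.\<close>

abbreviation noise_deriv :: "nat \<Rightarrow> real \<Rightarrow> 'w \<Rightarrow> real" where
  "noise_deriv \<equiv> response_deriv M f \<epsilon> 0"

abbreviation statistic :: "(nat \<Rightarrow> real set \<Rightarrow> real) \<Rightarrow> real ^ 'm \<Rightarrow> 'w \<Rightarrow> real" where
  "statistic \<equiv> linear_statistic M f \<epsilon> q T"

abbreviation noise_statistic :: "(nat \<Rightarrow> real set \<Rightarrow> real) \<Rightarrow> 'w \<Rightarrow> real" where
  "noise_statistic Q \<equiv> statistic Q 0"

abbreviation admissible :: "(nat \<Rightarrow> real set \<Rightarrow> real) \<Rightarrow> bool" where
  "admissible \<equiv> vector_measure M f \<epsilon> q T"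

section \<open>Mean-square derivatives of the response and of the noise\<close>

lemma const_square_integrable: "square_integrable M (\<lambda>\<omega>. a)"
  by (rule square_integrable_const) unfold_locales

lemma deriv_process_0: "deriv_process \<theta> 0 = response f \<epsilon> \<theta>"
  by (simp add: response_deriv_def ms_nderiv_def)

lemma noise_deriv_0: "noise_deriv 0 = \<epsilon>"
  by (simp add: deriv_process_0 response_def fun_eq_iff)

lemma deriv_process_Suc:
  assumes "i < q"
  shows "has_ms_derivative M (deriv_process \<theta> i) t (deriv_process \<theta> (Suc i) t)"
proof -
  have "\<exists>Z. has_ms_derivative M (deriv_process \<theta> i) t Z"
    using ms_differentiable[of \<theta>] assms
    by (simp add: ms_times_differentiable_def response_deriv_def)
  then show ?thesis
    unfolding response_deriv_def by (simp add: ms_nderiv_def) (erule someI_ex)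
qed

lemma deriv_process_square_integrable:
  assumes "i \<le> q"
  shows "square_integrable M (deriv_process \<theta> i t)"
proof (cases i)
  case 0
  then show ?thesis
    using ms_differentiable[of \<theta>] by (simp add: deriv_process_0 ms_times_differentiable_def)
next
  case (Suc j)
  then show ?thesis
    using deriv_process_Suc[of j \<theta> t] assms by (simp add: has_ms_derivative_def)
qed

lemma cross_deriv_process_has_derivative:
  assumes "i < q" "square_integrable M W"
  shows "((\<lambda>s. cross W (deriv_process \<theta> i s)) has_real_derivative
    cross W (deriv_process \<theta> (Suc i) t)) (at t)"
  using assms
  by (intro has_real_derivative_of_ms_derivative deriv_process_square_integrable deriv_process_Suc) auto

lemma nderiv_regressor_has_derivative:
  assumes "i < q"
  shows "((\<lambda>s. \<theta> \<bullet> nderiv i f s) has_real_derivative \<theta> \<bullet> nderiv (Suc i) f t) (at t)"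
proof -
  have "(nderiv i f has_vector_derivative nderiv (Suc i) f t) (at t)"
    using f_differentiable assms
    by (simp add: times_differentiable_def nderiv_def vector_derivative_works)
  then show ?thesis
    unfolding has_real_derivative_iff_has_vector_derivative
    by (rule bounded_linear.has_vector_derivative[OF bounded_linear_inner_right])
qed

text \<open>The versions picked by \<open>SOME\<close> for \<open>\<theta>\<close> and for 0 need
  not be related pointwise, so they are compared through inner products. In the induction step both
  sides are derivatives of the same real function and agree by uniqueness of derivatives.\<close>

lemma cross_deriv_process:
  assumes "i \<le> q" "square_integrable M W"
  shows "cross W (deriv_process \<theta> i t) =
    (\<theta> \<bullet> nderiv i f t) * expectation W + cross W (noise_deriv i t)"
  using assms(1)
proof (induction i arbitrary: t)
  case 0
  have "integrable M W"
    using square_integrable_mult[OF assms(2) const_square_integrable[of 1]] by simp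
  moreover have "integrable M (\<lambda>\<omega>. W \<omega> * \<epsilon> t \<omega>)"
    using square_integrable_mult[OF assms(2) deriv_process_square_integrable[of 0 0 t]]
    by (simp add: noise_deriv_0)
  ultimately show ?case
    unfolding noise_deriv_0 deriv_process_0 response_def
    by (simp add: distrib_left nderiv_def mult.commute[of "W _"])
next
  case (Suc i)
  then have "i < q" and IH: "\<And>t. cross W (deriv_process \<theta> i t) =
      (\<theta> \<bullet> nderiv i f t) * expectation W + cross W (noise_deriv i t)"
    by auto
  have "((\<lambda>s. (\<theta> \<bullet> nderiv i f s) * expectation W + cross W (noise_deriv i s)) has_real_derivative
      (\<theta> \<bullet> nderiv (Suc i) f t) * expectation W + cross W (noise_deriv (Suc i) t)) (at t)"
    using \<open>i < q\<close> assms(2)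
    by (intro DERIV_add DERIV_cmult_right nderiv_regressor_has_derivative
        cross_deriv_process_has_derivative)
  with cross_deriv_process_has_derivative[OF \<open>i < q\<close> assms(2), of \<theta> t]
  show ?case
    unfolding IH by (rule DERIV_unique)
qed

lemma deriv_process_AE:
  assumes "i \<le> q"
  shows "AE \<omega> in M. deriv_process \<theta> i t \<omega> = \<theta> \<bullet> nderiv i f t + noise_deriv i t \<omega>"
proof (rule AE_eq_of_weak_eq)
  fix W assume W: "square_integrable M W"
  have "integrable M W"
    using square_integrable_mult[OF W const_square_integrable[of 1]] by simp
  moreover have "integrable M (\<lambda>\<omega>. W \<omega> * noise_deriv i t \<omega>)"
    by (intro square_integrable_mult W deriv_process_square_integrable assms)
  ultimately show "cross W (deriv_process \<theta> i t)
      = cross W (\<lambda>\<omega>. \<theta> \<bullet> nderiv i f t + noise_deriv i t \<omega>)"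
    unfolding cross_deriv_process[OF assms W, of \<theta>] by (simp add: distrib_left mult.commute)
qed (intro deriv_process_square_integrable square_integrable_add const_square_integrable assms)+

text \<open>This exchange of differentiation and expectation links ordinary derivatives of the
  covariance kernel to mean-square derivatives of the noise.\<close>

lemma nderiv_cross_noise:
  assumes "square_integrable M W" "i \<le> q"
  shows "nderiv i (\<lambda>s. cross W (\<epsilon> s)) t = cross W (noise_deriv i t)"
  using assms(2)
proof (induction i arbitrary: t)
  case 0
  then show ?case
    by (simp add: nderiv_def noise_deriv_0)
next
  case (Suc i)
  then have IH: "nderiv i (\<lambda>s. cross W (\<epsilon> s)) = (\<lambda>s. cross W (noise_deriv i s))"
    by auto
  have "nderiv (Suc i) (\<lambda>s. cross W (\<epsilon> s)) t
      = vector_derivative (nderiv i (\<lambda>s. cross W (\<epsilon> s))) (at t)"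
    by (simp add: nderiv_def)
  also have "\<dots> = cross W (noise_deriv (Suc i) t)"
    unfolding IH using cross_deriv_process_has_derivative[of i W 0 t] Suc.prems assms(1)
    by (intro vector_derivative_at) (simp add: has_real_derivative_iff_has_vector_derivative)
  finally show ?case .
qed

lemma noise_deriv_mean:
  assumes "i \<le> q"
  shows "expectation (noise_deriv i t) = 0"
proof -
  have "nderiv i (\<lambda>s. 0 :: real) = (\<lambda>t. 0)"
    by (induction i) (auto simp: nderiv_def)
  then show ?thesis
    using nderiv_cross_noise[OF const_square_integrable[of 1] assms, of t]
    by (simp add: noise_mean)
qed

text \<open>The exchange is made twice, one argument at a time: first in the second argument against
  the fixed \<open>\<epsilon> u\<close>, then in the first against the fixed
  \<open>noise_deriv j s\<close>.\<close>

lemma cross_noise_deriv: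
  assumes "i \<le> q" "j \<le> q"
  shows "cross (noise_deriv i t) (noise_deriv j s) = kderiv i j (\<lambda>u v. cross (\<epsilon> u) (\<epsilon> v)) t s"
proof -
  have \<epsilon>: "square_integrable M (\<epsilon> u)" for u
    using deriv_process_square_integrable[of 0 0 u] by (simp add: noise_deriv_0)
  have "kderiv i j (\<lambda>u v. cross (\<epsilon> u) (\<epsilon> v)) t s = nderiv i (\<lambda>u. cross (noise_deriv j s) (\<epsilon> u)) t"
    unfolding kderiv_def nderiv_cross_noise[OF \<epsilon> assms(2)] by (simp add: mult.commute)
  also have "\<dots> = cross (noise_deriv i t) (noise_deriv j s)"
    by (subst nderiv_cross_noise)
      (auto simp: mult.commute assms intro: deriv_process_square_integrable)
  finally show ?thesis ..
qed

section \<open>Linear statistics and their inner products\<close>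

lemma ms_integral_deriv_process:
  assumes "admissible Q" "i \<le> q"
  shows "has_ms_integral M (T i) (Q i) (deriv_process \<theta> i)
    (ms_integral M (T i) (Q i) (deriv_process \<theta> i))"
proof -
  obtain Z where "has_ms_integral M (T i) (Q i) (deriv_process \<theta> i) Z"
    using assms unfolding vector_measure_def by blast
  then show ?thesis
    unfolding ms_integral_def by (rule someI[of "has_ms_integral M (T i) (Q i) (deriv_process \<theta> i)"])
qed

lemma signed_integrable_cross:
  assumes "admissible Q" "i \<le> q" "square_integrable M W"
  shows "signed_integrable (T i) (Q i) (\<lambda>t. cross W (deriv_process \<theta> i t))"
  using ms_integral_deriv_process[OF assms(1,2)] assms(3) by (auto simp: has_ms_integral_def)

lemma statistic_square_integrable:
  assumes "admissible Q"
  shows "square_integrable M (statistic Q \<theta>)"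
proof -
  have "square_integrable M (\<lambda>\<omega>. \<Sum>i\<le>q. ms_integral M (T i) (Q i) (deriv_process \<theta> i) \<omega>)"
    using ms_integral_deriv_process[OF assms]
    by (intro square_integrable_sum finite_measure_axioms) (auto simp: has_ms_integral_def)
  then show ?thesis
    by (simp add: linear_statistic_def[abs_def])
qed

lemma cross_ms_integral:
  assumes "admissible Q" "i \<le> q" "square_integrable M W"
  shows "cross W (ms_integral M (T i) (Q i) (deriv_process \<theta> i))
    = signed_integral (T i) (Q i) (\<lambda>t. cross W (deriv_process \<theta> i t))"
  using ms_integral_deriv_process[OF assms(1,2)] assms(3) by (auto simp: has_ms_integral_def)

lemma cross_statistic:
  assumes "admissible Q" "square_integrable M W"
  shows "cross W (statistic Q \<theta>)
    = (\<Sum>i\<le>q. signed_integral (T i) (Q i) (\<lambda>t. cross W (deriv_process \<theta> i t)))"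
proof -
  have "integrable M (\<lambda>\<omega>. W \<omega> * ms_integral M (T i) (Q i) (deriv_process \<theta> i) \<omega>)"
    if "i \<le> q" for i
    using ms_integral_deriv_process[OF assms(1) that] assms(2)
    by (intro square_integrable_mult) (auto simp: has_ms_integral_def)
  then have "cross W (statistic Q \<theta>)
      = (\<Sum>i\<le>q. cross W (ms_integral M (T i) (Q i) (deriv_process \<theta> i)))"
    by (simp add: linear_statistic_def sum_distrib_left)
  then show ?thesis
    by (simp add: cross_ms_integral assms)
qed

lemma expectation_deriv_process:
  assumes "i \<le> q"
  shows "expectation (deriv_process \<theta> i t) = \<theta> \<bullet> nderiv i f t"
  using cross_deriv_process[OF assms const_square_integrable[of 1], of \<theta> t]
    noise_deriv_mean[OF assms, of t] by (simp add: prob_space)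

text \<open>Existence of the mean-square integral contains this: the test variable 1 turns the
  response derivative into its mean.\<close>

lemma signed_integrable_regressor:
  assumes "admissible Q" "i \<le> q"
  shows "signed_integrable (T i) (Q i) (\<lambda>t. \<theta> \<bullet> nderiv i f t)"
  using signed_integrable_cross[OF assms const_square_integrable[of 1], of \<theta>]
  by (simp add: expectation_deriv_process assms)

lemma signed_integral_regressor:
  assumes "admissible Q"
  shows "(\<Sum>i\<le>q. signed_integral (T i) (Q i) (\<lambda>t. \<theta> \<bullet> nderiv i f t))
    = \<theta> \<bullet> regressor_integral f q T Q"
proof -
  \<comment> \<open>Coordinate \<open>k\<close> of the regressor is the mean belonging to the
    parameter \<open>axis k 1\<close>.\<close>
  have int: "signed_integrable (T i) (Q i) (\<lambda>t. nderiv i f t $ k)" if "i \<le> q" for i k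
    using signed_integrable_regressor[OF assms that, of "axis k 1"]
    by (simp add: inner_axis' )
  have "(\<Sum>i\<le>q. signed_integral (T i) (Q i) (\<lambda>t. \<theta> \<bullet> nderiv i f t))
    = (\<Sum>i\<le>q. \<Sum>k\<in>UNIV. \<theta> $ k * signed_integral (T i) (Q i) (\<lambda>t. nderiv i f t $ k))"
    by (intro sum.cong refl) (simp add: inner_vec_def signed_integral_sum_scale int)
  also have "\<dots> = \<theta> \<bullet> regressor_integral f q T Q"
    by (subst sum.swap) (simp add: inner_vec_def regressor_integral_def sum_distrib_left)
  finally show ?thesis .
qed

lemma cross_statistic_split:
  assumes "admissible Q" "square_integrable M W"
  shows "cross W (statistic Q \<theta>)
    = (\<theta> \<bullet> regressor_integral f q T Q) * expectation W + cross W (noise_statistic Q)"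
proof -
  have "cross W (statistic Q \<theta>) = (\<Sum>i\<le>q. signed_integral (T i) (Q i)
      (\<lambda>t. (\<theta> \<bullet> nderiv i f t) * expectation W + cross W (noise_deriv i t)))"
    unfolding cross_statistic[OF assms]
    by (intro sum.cong refl) (simp add: cross_deriv_process[of _ W \<theta>] assms)
  also have "\<dots> = (\<Sum>i\<le>q. signed_integral (T i) (Q i) (\<lambda>t. \<theta> \<bullet> nderiv i f t) * expectation W
      + signed_integral (T i) (Q i) (\<lambda>t. cross W (noise_deriv i t)))"
    by (intro sum.cong refl signed_integral_add_scale signed_integrable_regressor
        signed_integrable_cross assms) auto
  finally show ?thesis
    by (simp add: sum.distrib cross_statistic[OF assms] flip: sum_distrib_right
        signed_integral_regressor[OF assms(1)])
qed

lemma statistic_AE: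
  assumes "admissible Q"
  shows "AE \<omega> in M. statistic Q \<theta> \<omega> = \<theta> \<bullet> regressor_integral f q T Q + noise_statistic Q \<omega>"
proof (rule AE_eq_of_weak_eq)
  fix W assume W: "square_integrable M W"
  have "integrable M W"
    using square_integrable_mult[OF W const_square_integrable[of 1]] by simp
  moreover have "integrable M (\<lambda>\<omega>. W \<omega> * noise_statistic Q \<omega>)"
    by (intro square_integrable_mult W statistic_square_integrable assms)
  ultimately show "cross W (statistic Q \<theta>)
      = cross W (\<lambda>\<omega>. \<theta> \<bullet> regressor_integral f q T Q + noise_statistic Q \<omega>)"
    unfolding cross_statistic_split[OF assms W, of \<theta>] by (simp add: distrib_left mult.commute)
qed (intro statistic_square_integrable square_integrable_add const_square_integrable assms)+

lemma expectation_statistic: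
  assumes "admissible Q"
  shows "expectation (statistic Q \<theta>) = \<theta> \<bullet> regressor_integral f q T Q"
  using cross_statistic[OF assms const_square_integrable[of 1], of \<theta>]
  by (simp add: expectation_deriv_process signed_integral_regressor[OF assms])

text \<open>Both means are linear in \<open>\<theta>\<close>, and their equality for every
  \<open>\<theta>\<close> is equality of the coefficient vectors.\<close>

lemma unbiased_predictor_iff:
  assumes "p \<le> q"
  shows "unbiased_predictor M f \<epsilon> q T p t0 Q \<longleftrightarrow>
    admissible Q \<and> regressor_integral f q T Q = nderiv p f t0"
  by (auto simp: unbiased_predictor_def expectation_statistic expectation_deriv_process assms
      vector_eq_ldot)

text \<open>Unbiasedness cancels the deterministic parts almost surely, which leaves noise terms
  independent of \<open>\<theta>\<close>.\<close>

lemma mse_unbiased: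
  assumes "p \<le> q" "admissible Q" "regressor_integral f q T Q = nderiv p f t0"
  shows "mse M f \<epsilon> q T p t0 Q \<theta> = cross (noise_deriv p t0) (noise_deriv p t0)
    - 2 * cross (noise_deriv p t0) (noise_statistic Q)
    + cross (noise_statistic Q) (noise_statistic Q)"
proof -
  have sq: "square_integrable M (deriv_process \<phi> p t0)" "square_integrable M (statistic Q \<phi>)" for \<phi>
    using assms by (auto intro: deriv_process_square_integrable statistic_square_integrable)
  then have [measurable]: "deriv_process \<phi> p t0 \<in> borel_measurable M"
    "statistic Q \<phi> \<in> borel_measurable M" for \<phi>
    by (auto simp: square_integrable_def)
  have "mse M f \<epsilon> q T p t0 Q \<theta> = integral\<^sup>L M (\<lambda>\<omega>. (noise_deriv p t0 \<omega> - noise_statistic Q \<omega>)\<^sup>2)"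
    unfolding mse_def
  proof (rule integral_cong_AE)
    show "AE \<omega> in M. (deriv_process \<theta> p t0 \<omega> - statistic Q \<theta> \<omega>)\<^sup>2
        = (noise_deriv p t0 \<omega> - noise_statistic Q \<omega>)\<^sup>2"
      using deriv_process_AE[OF assms(1), of \<theta> t0] statistic_AE[OF assms(2), of \<theta>]
      by eventually_elim (simp add: assms(3))
  qed measurable
  also have "(\<lambda>\<omega>. (noise_deriv p t0 \<omega> - noise_statistic Q \<omega>)\<^sup>2)
      = (\<lambda>\<omega>. noise_deriv p t0 \<omega> * noise_deriv p t0 \<omega>
        - 2 * (noise_deriv p t0 \<omega> * noise_statistic Q \<omega>) + noise_statistic Q \<omega> * noise_statistic Q \<omega>)"
    by (simp add: power2_eq_square algebra_simps)
  finally show ?thesis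
    using sq by (simp add: square_integrable_mult)
qed

text \<open>Centering removes the deterministic part of each component, so the covariance does not
  depend on \<open>\<theta>\<close>.\<close>

lemma estimator_cov_eq:
  assumes "\<And>k. admissible (G k)"
  shows "estimator_cov M f \<epsilon> q T G \<theta> = (\<chi> k l. cross (noise_statistic (G k)) (noise_statistic (G l)))"
proof -
  have [measurable]: "statistic (G k) \<phi> \<in> borel_measurable M" for k \<phi>
    using statistic_square_integrable[OF assms] by (simp add: square_integrable_def)
  have AE: "AE \<omega> in M. statistic (G k) \<theta> \<omega> - expectation (statistic (G k) \<theta>) = noise_statistic (G k) \<omega>" for k
    using statistic_AE[OF assms, of k \<theta>] by eventually_elim (simp add: expectation_statistic assms)
  have "integral\<^sup>L M (\<lambda>\<omega>. (statistic (G k) \<theta> \<omega> - expectation (statistic (G k) \<theta>)) *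
      (statistic (G l) \<theta> \<omega> - expectation (statistic (G l) \<theta>)))
      = cross (noise_statistic (G k)) (noise_statistic (G l))" for k l
  proof (rule integral_cong_AE)
    show "AE \<omega> in M. (statistic (G k) \<theta> \<omega> - expectation (statistic (G k) \<theta>)) *
      (statistic (G l) \<theta> \<omega> - expectation (statistic (G l) \<theta>))
      = noise_statistic (G k) \<omega> * noise_statistic (G l) \<omega>"
      using AE[of k] AE[of l] by eventually_elim simp
  qed measurable
  then show ?thesis
    by (simp add: estimator_cov_def Let_def)
qed

end

section \<open>Linear combinations of measures\<close>

lemma has_ms_integral_add_scale:
  assumes "has_ms_integral M T \<nu> X Z" "has_ms_integral M T \<nu>' X Z'"
  shows "has_ms_integral M T (\<lambda>A. \<nu> A + a * \<nu>' A) X (\<lambda>\<omega>. Z \<omega> + a * Z' \<omega>)"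
  unfolding has_ms_integral_def
proof (intro conjI allI impI)
  have sq: "square_integrable M Z" "square_integrable M Z'"
    using assms by (auto simp: has_ms_integral_def)
  then show "square_integrable M (\<lambda>\<omega>. Z \<omega> + a * Z' \<omega>)"
    by (intro square_integrable_add square_integrable_scale)
  fix W assume W: "square_integrable M W"
  let ?g = "\<lambda>t. integral\<^sup>L M (\<lambda>\<omega>. W \<omega> * X t \<omega>)"
  have g: "signed_integrable T \<nu> ?g" "signed_integrable T \<nu>' ?g"
    and eq: "integral\<^sup>L M (\<lambda>\<omega>. W \<omega> * Z \<omega>) = signed_integral T \<nu> ?g"
      "integral\<^sup>L M (\<lambda>\<omega>. W \<omega> * Z' \<omega>) = signed_integral T \<nu>' ?g"
    using assms W by (auto simp: has_ms_integral_def)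
  show "signed_integrable T (\<lambda>A. \<nu> A + a * \<nu>' A) ?g"
    by (rule signed_integral_measure_add_scale(1)[OF g])
  have "integral\<^sup>L M (\<lambda>\<omega>. W \<omega> * (Z \<omega> + a * Z' \<omega>))
      = integral\<^sup>L M (\<lambda>\<omega>. W \<omega> * Z \<omega> + a * (W \<omega> * Z' \<omega>))"
    by (simp add: algebra_simps)
  also have "\<dots> = signed_integral T \<nu> ?g + a * signed_integral T \<nu>' ?g"
    using square_integrable_mult[OF W sq(1)] square_integrable_mult[OF W sq(2)] by (simp add: eq)
  finally show "integral\<^sup>L M (\<lambda>\<omega>. W \<omega> * (Z \<omega> + a * Z' \<omega>))
      = signed_integral T (\<lambda>A. \<nu> A + a * \<nu>' A) ?g"
    unfolding signed_integral_measure_add_scale(2)[OF g] .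
qed

context ms_regression
begin

lemma measures_add_scale:
  assumes "admissible Q" "admissible Q'"
  shows "admissible (\<lambda>j A. Q j A + a * Q' j A)"
  unfolding vector_measure_def
proof (intro allI impI conjI)
  fix i assume i: "i \<le> q"
  show "signed_measure_on (T i) (\<lambda>A. Q i A + a * Q' i A)"
    using assms i by (intro signed_measure_on_add_scale) (auto simp: vector_measure_def)
  fix \<theta>
  show "\<exists>Z. has_ms_integral M (T i) (\<lambda>A. Q i A + a * Q' i A) (deriv_process \<theta> i) Z"
    by (intro exI) (rule has_ms_integral_add_scale[OF ms_integral_deriv_process[OF assms(1) i]
          ms_integral_deriv_process[OF assms(2) i]])
qed

text \<open>Since \<open>ms_integral\<close> picks a version, the statistics themselves combine
  linearly only almost surely; their inner products do so exactly.\<close>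

lemma cross_noise_statistic_add_scale:
  assumes "admissible Q" "admissible Q'" "square_integrable M W"
  shows "cross W (noise_statistic (\<lambda>j A. Q j A + a * Q' j A))
    = cross W (noise_statistic Q) + a * cross W (noise_statistic Q')"
proof -
  have "cross W (noise_statistic (\<lambda>j A. Q j A + a * Q' j A))
      = (\<Sum>i\<le>q. signed_integral (T i) (Q i) (\<lambda>t. cross W (noise_deriv i t))
        + a * signed_integral (T i) (Q' i) (\<lambda>t. cross W (noise_deriv i t)))"
    unfolding cross_statistic[OF measures_add_scale[OF assms(1,2)] assms(3)]
    by (intro sum.cong refl signed_integral_measure_add_scale signed_integrable_cross assms) auto
  then show ?thesis
    by (simp add: sum.distrib sum_distrib_left cross_statistic assms)
qed

lemma regressor_integral_add_scale:
  assumes "admissible Q" "admissible Q'"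
  shows "regressor_integral f q T (\<lambda>j A. Q j A + a * Q' j A)
    = regressor_integral f q T Q + a *\<^sub>R regressor_integral f q T Q'"
proof -
  have "\<theta> \<bullet> regressor_integral f q T (\<lambda>j A. Q j A + a * Q' j A)
      = \<theta> \<bullet> (regressor_integral f q T Q + a *\<^sub>R regressor_integral f q T Q')" for \<theta>
  proof -
    have "\<theta> \<bullet> regressor_integral f q T (\<lambda>j A. Q j A + a * Q' j A)
        = (\<Sum>i\<le>q. signed_integral (T i) (Q i) (\<lambda>t. \<theta> \<bullet> nderiv i f t)
          + a * signed_integral (T i) (Q' i) (\<lambda>t. \<theta> \<bullet> nderiv i f t))"
      unfolding signed_integral_regressor[OF measures_add_scale[OF assms], symmetric]
      by (intro sum.cong refl signed_integral_measure_add_scale signed_integrable_regressor assms) auto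
    then show ?thesis
      by (simp add: sum.distrib inner_add_right assms signed_integral_regressor
          flip: sum_distrib_left)
  qed
  then show ?thesis
    using vector_eq_ldot by blast
qed

text \<open>The three conclusions are proved together because each induction step applies the binary
  rules, which require the partial combination to be admissible.\<close>

lemma linear_combination_of_measures:
  assumes "admissible Q" "\<And>k. admissible (G k)" "finite I"
  shows "admissible (\<lambda>j A. Q j A + (\<Sum>k\<in>I. a k * G k j A))
    \<and> regressor_integral f q T (\<lambda>j A. Q j A + (\<Sum>k\<in>I. a k * G k j A))
      = regressor_integral f q T Q + (\<Sum>k\<in>I. a k *\<^sub>R regressor_integral f q T (G k))
    \<and> (\<forall>W. square_integrable M W \<longrightarrow> cross W (noise_statistic (\<lambda>j A. Q j A + (\<Sum>k\<in>I. a k * G k j A)))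
      = cross W (noise_statistic Q) + (\<Sum>k\<in>I. a k * cross W (noise_statistic (G k))))"
  using assms(3)
proof induction
  case empty
  then show ?case
    using assms(1) by simp
next
  case (insert k I)
  let ?Q = "\<lambda>j A. Q j A + (\<Sum>k\<in>I. a k * G k j A)"
  have eq: "(\<lambda>j A. Q j A + (\<Sum>k\<in>insert k I. a k * G k j A)) = (\<lambda>j A. ?Q j A + a k * G k j A)"
    using insert.hyps by (simp add: fun_eq_iff)
  have Q: "admissible ?Q"
    using insert.IH by blast
  show ?case
    unfolding eq
    using insert.hyps insert.IH measures_add_scale[OF Q assms(2)[of k], of "a k"]
      regressor_integral_add_scale[OF Q assms(2)[of k], of "a k"]
      cross_noise_statistic_add_scale[OF Q assms(2)[of k], of _ "a k"] by simp
qed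

text \<open>Perturbing one row of the BLUE by multiples of \<open>H\<close> keeps it unbiased and cannot decrease
  the variance of that component.\<close>

lemma BLUE_orthogonal:
  assumes BLUE: "is_BLUE M f \<epsilon> q T G" and H: "admissible H" "regressor_integral f q T H = 0"
  shows "cross (noise_statistic (G k)) (noise_statistic H) = 0"
proof -
  have G: "admissible (G l)" for l
    using BLUE by (simp add: is_BLUE_def unbiased_estimator_def)
  let ?z = "noise_statistic (G k)" and ?h = "noise_statistic H"
  have sq: "square_integrable M ?z" "square_integrable M ?h"
    using G H by (auto intro: statistic_square_integrable)
  \<comment> \<open>The leading 0 fits the quadratic form of
    \<open>nonneg_quadratic_discriminant\<close> with \<open>a = 0\<close>.\<close>
  have "0 \<le> 0 + 2 * t * cross ?z ?h + t\<^sup>2 * cross ?h ?h" for t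
  proof -
    define Q where "Q = (\<lambda>j A. G k j A + t * H j A)"
    define G' where "G' = G(k := Q)"
    have Q: "admissible Q"
      unfolding Q_def by (intro measures_add_scale G H)
    then have G': "admissible (G' l)" for l
      using G by (simp add: G'_def)
    have "regressor_integral f q T Q = regressor_integral f q T (G k)"
      unfolding Q_def by (simp add: regressor_integral_add_scale G H)
    then have "regressor_integral f q T (G' l) = regressor_integral f q T (G l)" for l
      by (simp add: G'_def)
    then have "unbiased_estimator M f \<epsilon> q T G'"
      using BLUE G' by (simp add: is_BLUE_def unbiased_estimator_def)
    then have "loewner_le (estimator_cov M f \<epsilon> q T G 0) (estimator_cov M f \<epsilon> q T G' 0)"
      using BLUE by (simp add: is_BLUE_def)
    \<comment> \<open>The unit vector extracts from the Loewner inequality the comparison of the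
      variances of component \<open>k\<close>.\<close>
    then have "0 \<le> axis k 1 \<bullet> ((estimator_cov M f \<epsilon> q T G' 0 - estimator_cov M f \<epsilon> q T G 0) *v axis k 1)"
      by (simp add: loewner_le_def)
    then have "cross ?z ?z \<le> cross (noise_statistic Q) (noise_statistic Q)"
      unfolding estimator_cov_eq[OF G] estimator_cov_eq[OF G']
      by (simp add: matrix_vector_mult_basis inner_axis' column_def G'_def)
    \<comment> \<open>Linearity is available in the second argument only, so expansion alternates
      with symmetry.\<close>
    also have "\<dots> = cross (noise_statistic Q) ?z + t * cross (noise_statistic Q) ?h"
      by (subst (2) Q_def)
        (intro cross_noise_statistic_add_scale G H statistic_square_integrable Q)
    also have "\<dots> = cross ?z (noise_statistic Q) + t * cross ?h (noise_statistic Q)"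
      by (simp add: mult.commute)
    also have "\<dots> = (cross ?z ?z + t * cross ?z ?h) + t * (cross ?h ?z + t * cross ?h ?h)"
      unfolding Q_def by (simp add: cross_noise_statistic_add_scale G H sq)
    also have "cross ?h ?z = cross ?z ?h"
      by (simp add: mult.commute)
    finally show ?thesis
      by (simp add: algebra_simps power2_eq_square)
  qed
  then have "(cross ?z ?h)\<^sup>2 \<le> 0 * cross ?h ?h"
    by (rule nonneg_quadratic_discriminant) simp
  then show ?thesis
    by simp
qed

text \<open>The statistic of \<open>H\<close> integrates inner products over the sets
  \<open>T i\<close> only, so agreement at the observation points suffices.\<close>

lemma prediction_error_orthogonal:
  assumes "admissible \<zeta>" "admissible H" "p \<le> q"
    and "\<And>i s. i \<le> q \<Longrightarrow> s \<in> T i \<Longrightarrow>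
      cross (noise_statistic \<zeta>) (noise_deriv i s) = cross (noise_deriv p t0) (noise_deriv i s)"
  shows "cross (noise_statistic \<zeta>) (noise_statistic H) = cross (noise_deriv p t0) (noise_statistic H)"
  unfolding cross_statistic[OF assms(2) statistic_square_integrable[OF assms(1)]]
    cross_statistic[OF assms(2) deriv_process_square_integrable[OF assms(3)]]
  by (intro sum.cong refl signed_integral_cong assms(4)) auto

text \<open>The iterated integral arises by testing twice: the inner integral is the inner product
  of a mean-square integral of \<open>Q\<close> with \<open>noise_deriv j s\<close>, which is then
  integrated against \<open>Q'\<close>.\<close>

lemma cross_noise_statistics:
  assumes "admissible Q" "admissible Q'"
  shows "cross (noise_statistic Q) (noise_statistic Q') =
    (\<Sum>j\<le>q. \<Sum>i\<le>q. signed_integral (T j) (Q' j)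
      (\<lambda>s. signed_integral (T i) (Q i) (\<lambda>t. cross (noise_deriv i t) (noise_deriv j s))))"
proof -
  let ?Z = "\<lambda>i. ms_integral M (T i) (Q i) (noise_deriv i)"
  have inner: "signed_integral (T i) (Q i) (\<lambda>t. cross (noise_deriv i t) (noise_deriv j s))
      = cross (?Z i) (noise_deriv j s)" if "i \<le> q" "j \<le> q" for i j s
    using cross_ms_integral[OF assms(1) that(1) deriv_process_square_integrable[OF that(2)], of 0 s 0]
    by (simp add: mult.commute)
  have Z: "square_integrable M (?Z i)" if "i \<le> q" for i
    using ms_integral_deriv_process[OF assms(1) that] by (auto simp: has_ms_integral_def)
  \<comment> \<open>The factor 1 matches the shape of
    \<open>signed_integral_sum_scale\<close>.\<close>
  have "cross (noise_statistic Q) (noise_deriv j s) = (\<Sum>i\<le>q. 1 * cross (?Z i) (noise_deriv j s))"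
    if "j \<le> q" for j s
  proof -
    have "cross (noise_deriv j s) (noise_statistic Q) = (\<Sum>i\<le>q. cross (noise_deriv j s) (?Z i))"
      by (simp add: cross_statistic cross_ms_integral assms deriv_process_square_integrable that)
    then show ?thesis
      by (simp add: mult.commute)
  qed
  then have "cross (noise_statistic Q) (noise_statistic Q') = (\<Sum>j\<le>q. signed_integral (T j) (Q' j)
      (\<lambda>s. \<Sum>i\<le>q. 1 * cross (?Z i) (noise_deriv j s)))"
    unfolding cross_statistic[OF assms(2) statistic_square_integrable[OF assms(1)]] by simp
  also have "\<dots> = (\<Sum>j\<le>q. \<Sum>i\<le>q. 1 * signed_integral (T j) (Q' j) (\<lambda>s. cross (?Z i) (noise_deriv j s)))"
    by (intro sum.cong refl signed_integral_sum_scale)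
      (auto intro: signed_integrable_cross assms Z)
  finally show ?thesis
    by (simp add: inner)
qed

end

section \<open>Optimality of the predictor and its mean squared error\<close>

theorem theorem3p1:
  fixes M :: "'w measure"
    and f :: "real \<Rightarrow> real ^ 'm"
    and \<epsilon> :: "real \<Rightarrow> 'w \<Rightarrow> real"
    and K :: "real \<Rightarrow> real \<Rightarrow> real"
    and q p :: nat
    and T :: "nat \<Rightarrow> real set"
    and t0 :: real
    and G :: "'m \<Rightarrow> nat \<Rightarrow> real set \<Rightarrow> real"
    and \<zeta> Qs :: "nat \<Rightarrow> real set \<Rightarrow> real"
    and c :: "real ^ 'm"
    and D :: "real ^ 'm ^ 'm"
  assumes "prob_space M"
    and "p \<le> q"
    and "\<exists>i\<le>q. T i \<noteq> {}"
    and "t0 \<notin> T p"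
    and "times_differentiable q f"
    and "\<And>t. square_integrable M (\<epsilon> t)"
    and "\<And>t. integral\<^sup>L M (\<epsilon> t) = 0"
    and "\<And>t s. K t s = integral\<^sup>L M (\<lambda>\<omega>. \<epsilon> t \<omega> * \<epsilon> s \<omega>)"
    and "kernel_differentiable q K"
    and "\<And>\<theta>. ms_times_differentiable M q (response f \<epsilon> \<theta>)"
    and BLUE: "is_BLUE M f \<epsilon> q T G"
    and zeta: "vector_measure M f \<epsilon> q T \<zeta>"
    and zeta_eq: "\<And>i s. i \<le> q \<Longrightarrow> s \<in> T i \<Longrightarrow>
      (\<Sum>j\<le>q. signed_integral (T j) (\<zeta> j) (\<lambda>t. kderiv j i K t s)) = kderiv i p K s t0"
    and c: "c = nderiv p f t0 - regressor_integral f q T \<zeta>"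
    and Qs: "Qs = (\<lambda>j A. \<zeta> j A + (\<Sum>k\<in>UNIV. G k j A * c $ k))"
    and D: "D = (\<chi> k l. \<Sum>j\<le>q. \<Sum>i\<le>q.
      signed_integral (T j) (G l j) (\<lambda>s.
        signed_integral (T i) (G k i) (\<lambda>t. kderiv i j K t s)))"
  shows "is_BLUP_measure M f \<epsilon> q T p t0 Qs \<and>
    (\<forall>\<theta>. mse M f \<epsilon> q T p t0 Qs \<theta> =
       kderiv p p K t0 t0 + c \<bullet> (D *v nderiv p f t0)
       - (\<Sum>j\<le>q. signed_integral (T j) (Qs j) (\<lambda>t. kderiv j p K t t0))) \<and>
    (\<forall>\<theta>. estimator_cov M f \<epsilon> q T G \<theta> = D)"
proof -
  interpret prob_space M by fact
  interpret ms_regression M f \<epsilon> q T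
    by unfold_locales (use assms in auto)
  have G: "admissible (G k)" and reg_G: "regressor_integral f q T (G k) = axis k 1" for k
  proof -
    have "(\<chi> l k. regressor_integral f q T (G k) $ l) = mat 1"
      using BLUE by (simp add: is_BLUE_def unbiased_estimator_def)
    then show "regressor_integral f q T (G k) = axis k 1"
      by (simp add: vec_eq_iff mat_def axis_def)
  qed (use BLUE in \<open>simp add: is_BLUE_def unbiased_estimator_def\<close>)
  have K: "kderiv i j K t s = cross (noise_deriv i t) (noise_deriv j s)" if "i \<le> q" "j \<le> q" for i j t s
  proof -
    have "K = (\<lambda>u v. cross (\<epsilon> u) (\<epsilon> v))"
      using assms(8) by (simp add: fun_eq_iff)
    then show ?thesis
      using cross_noise_deriv[OF that] by simp
  qed
  note p = \<open>p \<le> q\<close>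
  let ?e = "noise_deriv p t0" and ?z = noise_statistic
  have e_sq: "square_integrable M ?e"
    by (rule deriv_process_square_integrable[OF p])
  have Qs_eq: "Qs = (\<lambda>j A. \<zeta> j A + (\<Sum>k\<in>UNIV. c $ k * G k j A))"
    by (simp add: Qs mult.commute)
  note lin = linear_combination_of_measures[of \<zeta> G UNIV "\<lambda>k. c $ k", OF zeta G finite_class.finite_UNIV,
      folded Qs_eq]
  have Qs_measures: "admissible Qs"
    using lin by blast
  have Qs_cross: "cross W (?z Qs) = cross W (?z \<zeta>) + (\<Sum>k\<in>UNIV. c $ k * cross W (?z (G k)))"
    if "square_integrable M W" for W
    using lin that by blast
  \<comment> \<open>The rows of \<open>G\<close> have the unit vectors as regressor integrals, so
    the correction term contributes exactly \<open>c\<close>, the bias left by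
    \<open>\<zeta>\<close>.\<close>
  have "(\<Sum>k\<in>UNIV. c $ k *\<^sub>R regressor_integral f q T (G k)) = c"
    by (simp add: reg_G vec_eq_iff axis_def if_distrib cong: if_cong)
  then have Qs_reg: "regressor_integral f q T Qs = nderiv p f t0"
    using lin c by simp
  have zeta_cross: "cross (?z \<zeta>) (?z H) = cross ?e (?z H)" if "admissible H" for H
  proof (rule prediction_error_orthogonal[OF zeta that p])
    fix i s assume i: "i \<le> q" and s: "s \<in> T i"
    \<comment> \<open>Read through \<open>K\<close>, the equation for \<open>\<zeta>\<close> is this
      equality of inner products.\<close>
    have "cross (noise_deriv i s) (?z \<zeta>) = cross (noise_deriv i s) ?e"
      unfolding cross_statistic[OF zeta deriv_process_square_integrable[OF i]] K[OF i p, symmetric]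
        zeta_eq[OF i s, symmetric]
      by (intro sum.cong refl) (simp add: K i mult.commute)
    then show "cross (?z \<zeta>) (noise_deriv i s) = cross ?e (noise_deriv i s)"
      by (simp add: mult.commute)
  qed
  have Qs_cross': "cross (?z Qs) (?z H) = cross ?e (?z H) + (\<Sum>k\<in>UNIV. c $ k * cross (?z (G k)) (?z H))"
    if "admissible H" for H
    using Qs_cross[OF statistic_square_integrable[OF that, of 0]] zeta_cross[OF that]
    by (simp add: mult.commute[of "?z H _"])
  have cov_D: "D = (\<chi> k l. cross (?z (G k)) (?z (G l)))"
    unfolding D by (simp add: cross_noise_statistics G K)
  have "mse M f \<epsilon> q T p t0 Qs \<theta> \<le> mse M f \<epsilon> q T p t0 Q \<theta>"
    if "unbiased_predictor M f \<epsilon> q T p t0 Q" for Q \<theta>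
  proof -
    have Q: "admissible Q" "regressor_integral f q T Q = nderiv p f t0"
      using that by (auto simp: unbiased_predictor_iff p)
    \<comment> \<open>As a difference of unbiased predictors, \<open>H\<close> has regressor
      integral zero, so the rows of the BLUE are uncorrelated with it.\<close>
    define H where "H = (\<lambda>j A. Q j A + - 1 * Qs j A)"
    have H: "admissible H"
      unfolding H_def by (rule measures_add_scale[OF Q(1) Qs_measures])
    have H_cross: "cross W (?z H) = cross W (?z Q) - cross W (?z Qs)" if "square_integrable M W" for W
      unfolding H_def using cross_noise_statistic_add_scale[OF Q(1) Qs_measures that, of "- 1"] by simp
    have "regressor_integral f q T H = 0"
      unfolding H_def regressor_integral_add_scale[OF Q(1) Qs_measures] by (simp add: Q Qs_reg)
    then have "cross (?z Qs) (?z H) = cross ?e (?z H)"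
      by (simp add: Qs_cross' H BLUE_orthogonal[OF BLUE])
    moreover note sq = statistic_square_integrable[OF Q(1), of 0]
      statistic_square_integrable[OF Qs_measures, of 0] statistic_square_integrable[OF H, of 0]
    moreover have "0 \<le> cross (?z H) (?z H)"
      by simp
    moreover have "cross (?z H) (?z Q) = cross (?z Q) (?z H)" "cross (?z H) (?z Qs) = cross (?z Qs) (?z H)"
      "cross (?z Qs) (?z Q) = cross (?z Q) (?z Qs)"
      by (simp_all add: mult.commute)
    \<comment> \<open>Pythagoras, with the inner products as atoms: the two errors differ by
      \<open>cross (?z H) (?z H)\<close>.\<close>
    ultimately show ?thesis
      unfolding mse_unbiased[OF p Q] mse_unbiased[OF p Qs_measures Qs_reg]
      using H_cross[OF e_sq] H_cross[OF sq(1)] H_cross[OF sq(2)] H_cross[OF sq(3)] by linarith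
  qed
  then have "is_BLUP_measure M f \<epsilon> q T p t0 Qs"
    using Qs_measures Qs_reg by (auto simp: is_BLUP_measure_def unbiased_predictor_iff p)
  moreover have "mse M f \<epsilon> q T p t0 Qs \<theta> =
       kderiv p p K t0 t0 + c \<bullet> (D *v nderiv p f t0)
       - (\<Sum>j\<le>q. signed_integral (T j) (Qs j) (\<lambda>t. kderiv j p K t t0))" for \<theta>
  proof -
    have cross_G: "cross (?z (G k)) (?z Qs) = (D *v nderiv p f t0) $ k" for k
    proof -
      \<comment> \<open>Subtracting the rows of \<open>G\<close> weighted by
        \<open>nderiv p f t0\<close> brings the regressor integral of \<open>Qs\<close> to zero.
        Orthogonality of \<open>G k\<close> to \<open>R\<close> then expresses its covariance with
        \<open>Qs\<close> through row \<open>k\<close> of \<open>D\<close>.\<close>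
      define R where "R = (\<lambda>j A. Qs j A + (\<Sum>l\<in>UNIV. - (nderiv p f t0 $ l) * G l j A))"
      note R_lin = linear_combination_of_measures[of Qs G UNIV "\<lambda>l. - (nderiv p f t0 $ l)",
          OF Qs_measures G finite_class.finite_UNIV, folded R_def]
      have "(\<Sum>l\<in>UNIV. - (nderiv p f t0 $ l) *\<^sub>R regressor_integral f q T (G l)) = - nderiv p f t0"
        by (simp add: reg_G vec_eq_iff axis_def if_distrib cong: if_cong)
      then have "regressor_integral f q T R = 0"
        using R_lin Qs_reg by simp
      then have "cross (?z (G k)) (?z R) = 0"
        using R_lin by (intro BLUE_orthogonal[OF BLUE]) auto
      moreover have "cross (?z (G k)) (?z R) = cross (?z (G k)) (?z Qs)
          + (\<Sum>l\<in>UNIV. - (nderiv p f t0 $ l) * cross (?z (G k)) (?z (G l)))"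
        using R_lin statistic_square_integrable[OF G, of k 0] by blast
      ultimately show ?thesis
        by (simp add: cov_D matrix_vector_mult_def sum_negf mult.commute)
    qed
    \<comment> \<open>Substituted into \<open>mse_unbiased\<close>, this cancels one of the two
      copies of \<open>cross ?e (?z Qs)\<close>, leaving the single integral in the error
      formula.\<close>
    have "cross (?z Qs) (?z Qs) = cross ?e (?z Qs) + c \<bullet> (D *v nderiv p f t0)"
      by (simp add: Qs_cross'[OF Qs_measures] cross_G inner_vec_def)
    moreover have "cross ?e (?z Qs) = (\<Sum>j\<le>q. signed_integral (T j) (Qs j) (\<lambda>t. kderiv j p K t t0))"
      unfolding cross_statistic[OF Qs_measures e_sq]
      by (intro sum.cong refl) (simp add: K p mult.commute)
    ultimately show ?thesis
      unfolding mse_unbiased[OF p Qs_measures Qs_reg] by (simp add: K p)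
  qed
  moreover have "estimator_cov M f \<epsilon> q T G \<theta> = D" for \<theta>
    by (simp add: estimator_cov_eq G cov_D)
  ultimately show ?thesis
    by blast
qed

end
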